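(* Let $p$ be a prime, let $\mathcal{G}=(G,U,Z_i,T_i,\lambda_i,\pi_i)_{i\in I}$ be a pro-$p$ linking structure, and let $V$ be a closed normal subgroup of $U$ with projection $\mathrm{pr}_{U,U/V}\colon U\to U/V$. Then: (a) Every globalization $\rho$ for $\mathcal{G}$ which maps $\lambda_i(\bar Z_i)$ into $V$ for every $i\in I$ induces a globalization $\bar\rho=\mathrm{pr}_{U,U/V}\circ\rho$ for $\mathcal{G}/V$ which is trivial on $\lambda_i(\bar Z_i)$ for every $i\in I$. (b) Assume that $\mathcal{G}$ has a $V$-link type. Then every globalization $\bar\rho$ for $\mathcal{G}/V$ which is trivial on $\lambda_i(\bar Z_i)$ for every $i\in I$ lifts uniquely to a globalization $\rho$ for $\mathcal{G}$ (that is, there is a unique globalization $\rho$ for $\mathcal G$ with $\mathrm{pr}_{U,U/V}\circ\rho=\bar\rho$), which moreover maps $\lambda_i(\bar Z_i)$ into $V$ for every $i\in I$.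
   Context: Homomorphisms of pro-$p$ groups are continuous. A (pro-$p$) linking structure $\mathcal{G}=(G,U,Z_i,T_i,\lambda_i,\pi_i)_{i\in I}$ consists of: pro-$p$ groups $G$ and $U$; an index set $I$; for each $i\in I$ a pro-$p$ group $Z_i$ and a closed normal subgroup $T_i$ of $Z_i$ together with a fixed homomorphic section of the natural epimorphism $Z_i\to\bar Z_i:=Z_i/T_i$ (so $Z_i=T_i\rtimes\bar Z_i$, and $\bar Z_i$ is regarded as a subgroup of $Z_i$ via the section); and for each $i\in I$ pro-$p$ group homomorphisms $\lambda_i\colon Z_i\to G$ and $\pi_i\colon T_i\to U$, such that $G$ is generated as a pro-$p$ group by the images $\lambda_i(T_i)$, $i\in I$. A globalization for $\mathcal{G}$ is a pro-$p$ group homomorphism $\rho\colon G\to U$ such that $\rho\circ\lambda_i|_{T_i}=\pi_i$ for every $i\in I$. For a closed normal subgroup $V$ of $U$, the quotient linking structure is $\mathcal{G}/V=(G,U/V,Z_i,T_i,\lambda_i,\mathrm{pr}_{U,U/V}\circ\pi_i)_{i\in I}$. Let $\hat T=\star_{i\in I}T_i$ be the free pro-$p$ product (coproduct of the $T_i$ in pro-$p$ groups), and let $\hat\lambda_T\colon\hat T\to G$ and $\hat\pi\colon\hat T\to U$ be the homomorphisms induced by the $\lambda_i|_{T_i}$ and by the $\pi_i$, respectively. For $i\in I$ set $\hat Z_i=\hat\lambda_T^{-1}(\lambda_i(\bar Z_i))\subseteq\hat T$. For a closed subgroup $V$ of $U$, the linking structure $\mathcal{G}$ has a $V$-link type if $\mathrm{Ker}(\hat\lambda_T)$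 is generated as a closed normal subgroup of $\hat T$ by elements of the sets $\mathrm{Ker}(\hat\pi)\cdot[\hat\pi^{-1}(C_U(V)),\hat Z_i]$ for certain indices $i\in I$, where $C_U(V)$ is the centralizer of $V$ in $U$ and $[\cdot,\cdot]$ denotes the closed commutator subgroup. *)

theory Defs
  imports
    "HOL-Analysis.Function_Topology"
    "HOL-Analysis.Abstract_Topological_Spaces"
    "HOL-Algebra.Product_Groups"
    "HOL-Computational_Algebra.Primes"
begin

no_notation eq_closure_of (\<open>closure'_of\<index>\<close>)

section \<open>Topological groups with explicit carrier\<close>

record 'a topgroup = "'a monoid" +
  topo :: "'a topology"

definition topological_group :: "'a topgroup \<Rightarrow> bool" where
  "topological_group G \<longleftrightarrow>
     group G \<and> topspace (topo G) = carrier G \<and>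
     continuous_map (prod_topology (topo G) (topo G)) (topo G) (\<lambda>(x, y). x \<otimes>\<^bsub>G\<^esub> y) \<and>
     continuous_map (topo G) (topo G) (\<lambda>x. inv\<^bsub>G\<^esub> x)"

text \<open>The intrinsic description of the inverse limits of finite p-groups: compact Hausdorff
  groups whose open normal subgroups of p-power index form a base of neighbourhoods of the
  identity. The equation for the index also forces it to be finite, because
  \<^const>\<open>card\<close> is 0 on infinite sets and \<open>p ^ k \<noteq> 0\<close> for a prime \<open>p\<close>.\<close>

definition pro_p_group :: "nat \<Rightarrow> 'a topgroup \<Rightarrow> bool" where
  "pro_p_group p G \<longleftrightarrow>
     topological_group G \<and> compact_space (topo G) \<and> Hausdorff_space (topo G) \<and>
     (\<forall>W. openin (topo G) W \<and> \<one>\<^bsub>G\<^esub> \<in> W \<longrightarrow>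
        (\<exists>N k. N \<lhd> G \<and> openin (topo G) N \<and> card (rcosets\<^bsub>G\<^esub> N) = p ^ k \<and> N \<subseteq> W))"

definition cont_hom :: "'a topgroup \<Rightarrow> 'b topgroup \<Rightarrow> ('a \<Rightarrow> 'b) set" where
  "cont_hom G H = {f \<in> hom G H. continuous_map (topo G) (topo H) f}"

definition subtopgroup :: "'a topgroup \<Rightarrow> 'a set \<Rightarrow> 'a topgroup" where
  "subtopgroup G H = G\<lparr>carrier := H, topo := subtopology (topo G) H\<rparr>"

definition quotient_topgroup :: "'a topgroup \<Rightarrow> 'a set \<Rightarrow> 'a set topgroup" where
  "quotient_topgroup G N =
     \<lparr>carrier = carrier (G Mod N), monoid.mult = monoid.mult (G Mod N), one = one (G Mod N),
      topo = topology (\<lambda>\<X>. \<X> \<subseteq> carrier (G Mod N) \<and> openin (topo G) (\<Union>\<X>))\<rparr>"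

lemma openin_quotient_topgroup:
  fixes G (structure)
  assumes N: "N \<lhd> G"
  shows "openin (topo (quotient_topgroup G N)) \<X> \<longleftrightarrow>
    \<X> \<subseteq> carrier (G Mod N) \<and> openin (topo G) (\<Union>\<X>)"
proof -
  interpret normal N G by fact
  have int: "\<Union>(\<X> \<inter> \<Y>) = \<Union>\<X> \<inter> \<Union>\<Y>" if "\<X> \<subseteq> carrier (G Mod N)" "\<Y> \<subseteq> carrier (G Mod N)" for \<X> \<Y>
  proof (intro equalityI subsetI)
    fix x assume "x \<in> \<Union>\<X> \<inter> \<Union>\<Y>"
    then obtain A B where AB: "A \<in> \<X>" "B \<in> \<Y>" "x \<in> A" "x \<in> B" by blast
    then have "A \<in> rcosets N" "B \<in> rcosets N" using that by (auto simp: FactGroup_def)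
    then have "A = B" using rcos_disjoint[OF subgroup_axioms] AB(3,4) by (meson disjnt_iff pairwiseD)
    then show "x \<in> \<Union>(\<X> \<inter> \<Y>)" using AB by blast
  qed blast
  have "istopology (\<lambda>\<X>. \<X> \<subseteq> carrier (G Mod N) \<and> openin (topo G) (\<Union>\<X>))"
    unfolding istopology_def
  proof (intro conjI allI impI)
    fix \<K> assume K: "\<forall>K\<in>\<K>. K \<subseteq> carrier (G Mod N) \<and> openin (topo G) (\<Union>K)"
    then show "\<Union>\<K> \<subseteq> carrier (G Mod N)" by blast
    have "openin (topo G) (\<Union>K\<in>\<K>. \<Union>K)" using K by blast
    moreover have "\<Union>(\<Union>\<K>) = (\<Union>K\<in>\<K>. \<Union>K)" by blast
    ultimately show "openin (topo G) (\<Union>(\<Union>\<K>))" by simp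
  qed (auto simp: int)
  then show ?thesis by (simp add: quotient_topgroup_def topology_inverse')
qed

definition quotient_proj :: "'a topgroup \<Rightarrow> 'a set \<Rightarrow> 'a \<Rightarrow> 'a set" where
  "quotient_proj G N x = N #>\<^bsub>G\<^esub> x"

definition closed_subgroup_generated :: "'a topgroup \<Rightarrow> 'a set \<Rightarrow> 'a set" where
  "closed_subgroup_generated G S = topo G closure_of generate G S"

definition closed_normal_subgroup_generated :: "'a topgroup \<Rightarrow> 'a set \<Rightarrow> 'a set" where
  "closed_normal_subgroup_generated G S = \<Inter>{N. N \<lhd> G \<and> closedin (topo G) N \<and> S \<subseteq> N}"

text \<open>The two usual conventions for the commutator of \<open>a\<close> and \<open>b\<close> give the same closed
  commutator subgroup whenever \<open>A\<close> and \<open>B\<close> are subgroups.\<close>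

definition closed_commutator_subgroup :: "'a topgroup \<Rightarrow> 'a set \<Rightarrow> 'a set \<Rightarrow> 'a set" where
  "closed_commutator_subgroup G A B =
     closed_subgroup_generated G
       {inv\<^bsub>G\<^esub> a \<otimes>\<^bsub>G\<^esub> inv\<^bsub>G\<^esub> b \<otimes>\<^bsub>G\<^esub> a \<otimes>\<^bsub>G\<^esub> b | a b. a \<in> A \<and> b \<in> B}"

definition centralizer :: "'a topgroup \<Rightarrow> 'a set \<Rightarrow> 'a set" where
  "centralizer G V = {x \<in> carrier G. \<forall>v\<in>V. x \<otimes>\<^bsub>G\<^esub> v = v \<otimes>\<^bsub>G\<^esub> x}"

section \<open>Free pro-p products\<close>

text \<open>The coproduct of pro-p groups \<open>T i\<close>, \<open>i \<in> I\<close>, is realised as the closed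
  subgroup topologically generated by the diagonal images of the \<open>T i\<close> in the product
  of all finite p-groups \<open>F\<close> that receive a family of continuous homomorphisms
  \<open>f i : T i \<rightarrow> F\<close>; one factor for each pair \<open>(F, f)\<close>. It is enough to let \<open>F\<close> range over the
  groups whose elements are natural numbers, since every finite group is isomorphic to one of
  them. The universal property with respect to all pro-p groups is proved in
  \<open>free_pro_p_product_universal\<close> below.\<close>

definition free_pro_p_index ::
    "nat \<Rightarrow> 'i set \<Rightarrow> ('i \<Rightarrow> 'a topgroup) \<Rightarrow> (nat monoid \<times> ('i \<Rightarrow> 'a \<Rightarrow> nat)) set" where
  "free_pro_p_index p I T =
     {(F, f). group F \<and> (\<exists>k. card (carrier F) = p ^ k) \<and>
        (\<forall>i\<in>I. f i \<in> hom (T i) F \<and>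
           continuous_map (topo (T i)) (discrete_topology (carrier F)) (f i))}"

definition free_pro_p_ambient ::
    "nat \<Rightarrow> 'i set \<Rightarrow> ('i \<Rightarrow> 'a topgroup) \<Rightarrow>
       (nat monoid \<times> ('i \<Rightarrow> 'a \<Rightarrow> nat) \<Rightarrow> nat) topgroup" where
  "free_pro_p_ambient p I T =
     (let X = free_pro_p_index p I T; P = product_group X fst in
      \<lparr>carrier = carrier P, monoid.mult = monoid.mult P, one = one P,
       topo = product_topology (\<lambda>k. discrete_topology (carrier (fst k))) X\<rparr>)"

definition free_pro_p_incl ::
    "nat \<Rightarrow> 'i set \<Rightarrow> ('i \<Rightarrow> 'a topgroup) \<Rightarrow> 'i \<Rightarrow> 'a \<Rightarrow>
       (nat monoid \<times> ('i \<Rightarrow> 'a \<Rightarrow> nat) \<Rightarrow> nat)" where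
  "free_pro_p_incl p I T i t = (\<lambda>k\<in>free_pro_p_index p I T. snd k i t)"

definition free_pro_p_product ::
    "nat \<Rightarrow> 'i set \<Rightarrow> ('i \<Rightarrow> 'a topgroup) \<Rightarrow>
       (nat monoid \<times> ('i \<Rightarrow> 'a \<Rightarrow> nat) \<Rightarrow> nat) topgroup" where
  "free_pro_p_product p I T =
     subtopgroup (free_pro_p_ambient p I T)
       (closed_subgroup_generated (free_pro_p_ambient p I T)
          (\<Union>i\<in>I. free_pro_p_incl p I T i ` carrier (T i)))"

subsection \<open>The universal property\<close>

lemma subtopgroup_simps [simp]:
  "carrier (subtopgroup G H) = H" "monoid.mult (subtopgroup G H) = monoid.mult G"
  "one (subtopgroup G H) = one G" "topo (subtopgroup G H) = subtopology (topo G) H"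
  by (simp_all add: subtopgroup_def)

lemma topological_group_closure_subgroup:
  fixes G (structure)
  assumes G: "topological_group G" and H: "subgroup H G"
  shows "subgroup (topo G closure_of H) G"
proof -
  interpret group G using G by (simp add: topological_group_def)
  have ts: "topspace (topo G) = carrier G" using G by (simp add: topological_group_def)
  let ?C = "topo G closure_of H"
  have "(\<lambda>(x, y). x \<otimes>\<^bsub>G\<^esub> y) ` (?C \<times> ?C) \<subseteq> topo G closure_of ((\<lambda>(x, y). x \<otimes>\<^bsub>G\<^esub> y) ` (H \<times> H))"
    using continuous_map_image_closure_subset[of "prod_topology (topo G) (topo G)" "topo G" "\<lambda>(x, y). x \<otimes>\<^bsub>G\<^esub> y" "H \<times> H"] G
    by (simp add: topological_group_def closure_of_Times)
  also have "\<dots> \<subseteq> ?C"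
    using H by (intro closure_of_mono) (auto simp: subgroup_def)
  finally have m: "x \<otimes> y \<in> ?C" if "x \<in> ?C" "y \<in> ?C" for x y
    using that by auto
  have "(\<lambda>x. inv x) ` ?C \<subseteq> topo G closure_of ((\<lambda>x. inv x) ` H)"
    using G by (intro continuous_map_image_closure_subset) (simp add: topological_group_def)
  also have "\<dots> \<subseteq> ?C"
    using H by (intro closure_of_mono) (auto simp: subgroup_def)
  finally have i: "inv x \<in> ?C" if "x \<in> ?C" for x
    using that by auto
  have "H \<subseteq> ?C" using H by (intro closure_of_subset) (auto simp: subgroup_def ts)
  then have "\<one> \<in> ?C" using H by (auto simp: subgroup_def)
  then show ?thesis
    using m i closure_of_subset_topspace[of "topo G" H]
    by (auto intro!: subgroup.intro simp: ts)
qed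

lemma topological_group_subtopgroup:
  fixes G (structure)
  assumes G: "topological_group G" and H: "subgroup H G"
  shows "topological_group (subtopgroup G H)"
proof -
  interpret group G using G by (simp add: topological_group_def)
  have ts: "topspace (topo G) = carrier G" using G by (simp add: topological_group_def)
  have HG: "H \<subseteq> carrier G" using H by (simp add: subgroup_def)
  have eq: "inv\<^bsub>subtopgroup G H\<^esub> x = inv x" if "x \<in> H" for x
    using that m_inv_consistent[OF H that] by (simp add: m_inv_def)
  have "group (subtopgroup G H)"
  proof (rule groupI)
    show "\<exists>y\<in>carrier (subtopgroup G H). y \<otimes>\<^bsub>subtopgroup G H\<^esub> x = \<one>\<^bsub>subtopgroup G H\<^esub>"
      if "x \<in> carrier (subtopgroup G H)" for x
      using H that HG by (auto intro!: bexI[of _ "inv x"] simp: subgroup.m_inv_closed subset_iff)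
  qed (use H HG in \<open>auto simp: subgroup.m_closed subgroup.one_closed subset_iff m_assoc\<close>)
  moreover have "continuous_map (subtopology (topo G) H) (subtopology (topo G) H) (\<lambda>x. inv\<^bsub>subtopgroup G H\<^esub> x)"
    unfolding continuous_map_in_subtopology
  proof
    show "continuous_map (subtopology (topo G) H) (topo G) (m_inv (subtopgroup G H))"
      using G by (auto intro!: continuous_map_eq[OF continuous_map_from_subtopology[of "topo G" "topo G" "m_inv G" H]] simp: eq topological_group_def)
  qed (use H in \<open>auto simp: eq subgroup_def\<close>)
  moreover have "continuous_map (prod_topology (subtopology (topo G) H) (subtopology (topo G) H)) (subtopology (topo G) H) (\<lambda>(x, y). x \<otimes>\<^bsub>G\<^esub> y)"
    unfolding subtopology_Times[symmetric] continuous_map_in_subtopology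
    using G H by (auto simp: topological_group_def subgroup_def intro!: continuous_map_from_subtopology)
  ultimately show ?thesis
    using HG by (auto simp: topological_group_def ts)
qed

lemma card_rcosets_kernel_p_power:
  fixes p :: nat
  assumes p: "prime p" and h: "group_hom G P h" and P: "card (carrier P) = p ^ k"
  shows "\<exists>m. card (rcosets\<^bsub>G\<^esub> (kernel G P h)) = p ^ m"
proof -
  interpret group_hom G P h by fact
  let ?Q = "P\<lparr>carrier := h ` carrier G\<rparr>"
  have sub: "subgroup (h ` carrier G) P" by (rule img_is_subgroup)
  interpret Q: group ?Q using sub by (rule H.subgroup_imp_group)
  interpret hq: group_hom G ?Q h
    by unfold_locales (auto simp: hom_def)
  have ker: "kernel G ?Q h = kernel G P h" by (simp add: kernel_def)
  have "order (G Mod kernel G P h) = order ?Q"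
    using iso_same_order[OF hq.FactGroup_iso_set] by (simp add: ker)
  then have "card (rcosets\<^bsub>G\<^esub> (kernel G P h)) = card (h ` carrier G)"
    by (simp add: order_def FactGroup_def)
  moreover have "card (h ` carrier G) dvd p ^ k"
    using H.lagrange[OF sub] P by (metis dvd_triv_right order_def)
  ultimately show ?thesis using divides_primepow_nat[OF p] by metis
qed

lemma pro_p_group_closed_subgroup:
  fixes p :: nat and G (structure)
  assumes p: "prime p" and G: "pro_p_group p G" and H: "subgroup H G" "closedin (topo G) H"
  shows "pro_p_group p (subtopgroup G H)"
proof -
  have tg: "topological_group G" and cG: "compact_space (topo G)" and hG: "Hausdorff_space (topo G)"
    using G by (auto simp: pro_p_group_def)
  interpret group G using tg by (simp add: topological_group_def)
  have tgH: "topological_group (subtopgroup G H)" by (rule topological_group_subtopgroup[OF tg H(1)])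
  interpret K: group "subtopgroup G H" using tgH by (simp add: topological_group_def)
  have cs: "compact_space (subtopology (topo G) H)"
    using closedin_compact_space[OF cG H(2)] by (simp add: compactin_subspace)
  have "\<exists>N k. N \<lhd> subtopgroup G H \<and> openin (subtopology (topo G) H) N \<and> card (rcosets\<^bsub>subtopgroup G H\<^esub> N) = p ^ k \<and> N \<subseteq> W"
    if W: "openin (subtopology (topo G) H) W" "\<one> \<in> W" for W
  proof -
    obtain W' where W': "openin (topo G) W'" "W = W' \<inter> H" using W(1) by (auto simp: openin_subtopology)
    then obtain N k where N: "N \<lhd> G" "openin (topo G) N" "card (rcosets N) = p ^ k" "N \<subseteq> W'"
      using G W(2) unfolding pro_p_group_def by blast
    interpret N: normal N G by fact
    interpret Q: group "G Mod N" by (rule N.factorgroup_is_group)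
    have hom: "group_hom (subtopgroup G H) (G Mod N) (\<lambda>x. N #> x)"
      using N.r_coset_hom_Mod H(1)
      by (intro group_hom.intro group_hom_axioms.intro K.is_group Q.is_group)
         (auto simp: hom_def subgroup_def subset_iff)
    have "kernel (subtopgroup G H) (G Mod N) (\<lambda>x. N #> x) = N \<inter> H"
      using H(1) by (auto simp: kernel_def FactGroup_def subgroup_def subset_iff N.rcos_const
          dest: N.rcos_module_imp intro: coset_join1[OF _ _ N.subgroup_axioms])
    moreover have "openin (subtopology (topo G) H) (N \<inter> H)"
      using N(2) by (auto simp: openin_subtopology)
    ultimately show ?thesis
      using group_hom.normal_kernel[OF hom] card_rcosets_kernel_p_power[OF p hom, of k] N W'
      by (auto simp: FactGroup_def intro!: exI[of _ "N \<inter> H"])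
  qed
  then show ?thesis
    using tgH cs hG by (auto simp: pro_p_group_def Hausdorff_space_subtopology)
qed


lemma group_cong:
  assumes "group G" "carrier K = carrier G" "monoid.mult K = monoid.mult G" "one K = one G"
  shows "group K"
proof -
  interpret group G by fact
  show ?thesis
    by (rule groupI) (auto simp: assms(2-4) m_assoc intro: l_inv_ex)
qed

lemma inv_cong:
  assumes "carrier K = carrier G" "monoid.mult K = monoid.mult G" "one K = one G"
  shows "inv\<^bsub>K\<^esub> x = inv\<^bsub>G\<^esub> x"
  by (simp add: m_inv_def assms)

lemma free_pro_p_ambient_simps:
  "carrier (free_pro_p_ambient p I T) = (\<Pi>\<^sub>E k\<in>free_pro_p_index p I T. carrier (fst k))"
  "x \<otimes>\<^bsub>free_pro_p_ambient p I T\<^esub> y = (\<lambda>k\<in>free_pro_p_index p I T. x k \<otimes>\<^bsub>fst k\<^esub> y k)"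
  "\<one>\<^bsub>free_pro_p_ambient p I T\<^esub> = (\<lambda>k\<in>free_pro_p_index p I T. \<one>\<^bsub>fst k\<^esub>)"
  "topo (free_pro_p_ambient p I T) =
     product_topology (\<lambda>k. discrete_topology (carrier (fst k))) (free_pro_p_index p I T)"
  by (simp_all add: free_pro_p_ambient_def Let_def)

lemma free_pro_p_index_group:
  assumes "k \<in> free_pro_p_index p I T"
  shows "group (fst k)" "\<exists>m. card (carrier (fst k)) = p ^ m"
  using assms by (auto simp: free_pro_p_index_def)

lemma pro_p_group_ambient:
  fixes p :: nat
  assumes p: "prime p"
  shows "pro_p_group p (free_pro_p_ambient p I T)"
proof -
  let ?A = "free_pro_p_ambient p I T" and ?X = "free_pro_p_index p I T"
  let ?D = "\<lambda>k. discrete_topology (carrier (fst k))"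
  note simps = free_pro_p_ambient_simps
  have gr: "group (fst k)" if "k \<in> ?X" for k using that by (rule free_pro_p_index_group)
  have pg: "group (product_group ?X fst)" using gr by (rule product_group)
  have g: "group ?A"
    by (rule group_cong[OF pg]) (auto simp: free_pro_p_ambient_def Let_def)
  have fin: "finite (carrier (fst k))" if "k \<in> ?X" for k
    using free_pro_p_index_group(2)[OF that] p
    by (metis card.infinite not_prime_0 power_eq_0_iff)
  have inv: "inv\<^bsub>?A\<^esub> x = (\<lambda>k\<in>?X. inv\<^bsub>fst k\<^esub> x k)" if "x \<in> carrier ?A" for x
  proof -
    have "inv\<^bsub>?A\<^esub> x = inv\<^bsub>product_group ?X fst\<^esub> x"
      by (rule inv_cong) (auto simp: free_pro_p_ambient_def Let_def)
    also have "\<dots> = (\<lambda>k\<in>?X. inv\<^bsub>fst k\<^esub> x k)"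
      using that gr by (intro inv_product_group) (auto simp: simps)
    finally show ?thesis .
  qed
  have "continuous_map (prod_topology (topo ?A) (topo ?A)) (?D k) (\<lambda>z. fst z k \<otimes>\<^bsub>fst k\<^esub> snd z k)"
    if k: "k \<in> ?X" for k
  proof -
    have "continuous_map (prod_topology (topo ?A) (topo ?A)) (prod_topology (?D k) (?D k)) (\<lambda>z. (fst z k, snd z k))"
      using k unfolding simps
      by (intro continuous_map_pairedI continuous_map_compose[OF continuous_map_fst, unfolded comp_def]
            continuous_map_compose[OF continuous_map_snd, unfolded comp_def] continuous_map_product_coordinates)
    moreover have "continuous_map (prod_topology (?D k) (?D k)) (?D k) (\<lambda>(a, b). a \<otimes>\<^bsub>fst k\<^esub> b)"
      using gr[OF k] by (auto simp flip: prod_topology_discrete_topology simp: group.is_monoid monoid.m_closed)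
    ultimately show ?thesis
      by (rule continuous_map_compose[THEN continuous_map_eq]) (auto simp: split_beta)
  qed
  then have "continuous_map (prod_topology (topo ?A) (topo ?A)) (topo ?A) (\<lambda>(x, y). x \<otimes>\<^bsub>?A\<^esub> y)"
    by (auto simp: simps continuous_map_componentwise split_beta cong: restrict_cong)
  moreover have "continuous_map (topo ?A) (topo ?A) (\<lambda>x. inv\<^bsub>?A\<^esub> x)"
  proof (rule continuous_map_eq)
    have "continuous_map (topo ?A) (?D k) (\<lambda>x. inv\<^bsub>fst k\<^esub> x k)" if k: "k \<in> ?X" for k
    proof -
      have "continuous_map (topo ?A) (?D k) (\<lambda>x. x k)"
        using k unfolding simps by (intro continuous_map_product_coordinates)
      moreover have "continuous_map (?D k) (?D k) (\<lambda>a. inv\<^bsub>fst k\<^esub> a)"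
        using gr[OF k] by auto
      ultimately show ?thesis
        by (rule continuous_map_compose[THEN continuous_map_eq]) auto
    qed
    then show "continuous_map (topo ?A) (topo ?A) (\<lambda>x. \<lambda>k\<in>?X. inv\<^bsub>fst k\<^esub> x k)"
      by (auto simp: simps continuous_map_componentwise)
  qed (auto simp: inv simps)
  ultimately have tg: "topological_group ?A"
    using g by (simp add: topological_group_def simps)
  have base: "\<exists>N k. N \<lhd> ?A \<and> openin (topo ?A) N \<and> card (rcosets\<^bsub>?A\<^esub> N) = p ^ k \<and> N \<subseteq> W"
    if W: "openin (topo ?A) W" "\<one>\<^bsub>?A\<^esub> \<in> W" for W
  proof -
    obtain U where U: "finite {k\<in>?X. U k \<noteq> carrier (fst k)}" "\<one>\<^bsub>?A\<^esub> \<in> PiE ?X U" "PiE ?X U \<subseteq> W"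
      using W unfolding simps(4) openin_product_topology_alt topspace_discrete_topology by blast
    define J where "J = {k\<in>?X. U k \<noteq> carrier (fst k)}"
    have J: "finite J" "J \<subseteq> ?X" using U by (auto simp: J_def)
    let ?P = "product_group J fst"
    have "group ?P" using gr J by (intro product_group) auto
    then have hom: "group_hom ?A ?P (\<lambda>x. restrict x J)"
      using J by (intro group_hom.intro g group_hom_axioms.intro)
        (auto simp: hom_def simps fun_eq_iff restrict_def Pi_iff PiE_iff extensional_def)
    have "\<forall>k\<in>?X. \<exists>n. card (carrier (fst k)) = p ^ n"
      using free_pro_p_index_group(2) by blast
    from bchoice[OF this] obtain m where m: "\<And>k. k \<in> ?X \<Longrightarrow> card (carrier (fst k)) = p ^ m k"
      by blast
    have "card (carrier ?P) = (\<Prod>k\<in>J. p ^ m k)"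
      using J m by (auto simp: card_PiE intro!: prod.cong)
    then have "card (carrier ?P) = p ^ sum m J" by (simp add: power_sum)
    from card_rcosets_kernel_p_power[OF p hom this] obtain n where
      n: "card (rcosets\<^bsub>?A\<^esub> (kernel ?A ?P (\<lambda>x. restrict x J))) = p ^ n" ..
    have ker: "kernel ?A ?P (\<lambda>x. restrict x J) = (\<Pi>\<^sub>E k\<in>?X. if k \<in> J then {\<one>\<^bsub>fst k\<^esub>} else carrier (fst k))"
      (is "?L = ?R")
    proof (intro equalityI subsetI)
      fix x assume x: "x \<in> ?L"
      then have "restrict x J = (\<lambda>k\<in>J. \<one>\<^bsub>fst k\<^esub>)" by (simp add: kernel_def)
      then have "x k = \<one>\<^bsub>fst k\<^esub>" if "k \<in> J" for k using that by (metis restrict_apply')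
      then show "x \<in> ?R" using x by (auto simp: kernel_def simps PiE_iff)
    next
      fix x assume x: "x \<in> ?R"
      have "x k = \<one>\<^bsub>fst k\<^esub>" if "k \<in> J" for k
        using PiE_mem[OF x, of k] that J by auto
      moreover have "x k \<in> carrier (fst k)" if "k \<in> ?X" for k
        using PiE_mem[OF x that] gr[OF that] by (auto simp: group.is_monoid split: if_splits)
      ultimately show "x \<in> ?L" using x by (auto simp: kernel_def simps PiE_iff)
    qed
    have "openin (topo ?A) (kernel ?A ?P (\<lambda>x. restrict x J))"
      unfolding ker simps(4) openin_PiE_gen
      using J gr by (auto simp: group.is_monoid subset_iff intro: finite_subset[OF _ J(1)])
    moreover have "kernel ?A ?P (\<lambda>x. restrict x J) \<subseteq> W"
    proof -
      have "kernel ?A ?P (\<lambda>x. restrict x J) \<subseteq> PiE ?X U"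
        unfolding ker using U(2) by (intro PiE_mono) (auto simp: J_def simps)
      then show ?thesis using U(3) by blast
    qed
    ultimately show ?thesis
      using n group_hom.normal_kernel[OF hom] by blast
  qed
  have "compact_space (topo ?A)" "Hausdorff_space (topo ?A)"
    using fin by (auto simp: simps compact_space_product_topology Hausdorff_space_product_topology
        compact_space_discrete_topology Hausdorff_space_discrete_topology)
  with tg base show ?thesis by (auto simp: pro_p_group_def)
qed

lemma closed_subgroup_generated_props:
  fixes G (structure)
  assumes G: "topological_group G" and S: "S \<subseteq> carrier G"
  shows "subgroup (closed_subgroup_generated G S) G"
    and "closedin (topo G) (closed_subgroup_generated G S)"
    and "S \<subseteq> closed_subgroup_generated G S"
    and "\<And>K. subgroup K G \<Longrightarrow> closedin (topo G) K \<Longrightarrow> S \<subseteq> K \<Longrightarrow> closed_subgroup_generated G S \<subseteq> K"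
proof -
  interpret group G using G by (simp add: topological_group_def)
  have ts: "topspace (topo G) = carrier G" using G by (simp add: topological_group_def)
  have sg: "subgroup (generate G S) G" by (rule generate_is_subgroup[OF S])
  show "subgroup (closed_subgroup_generated G S) G"
    unfolding closed_subgroup_generated_def by (rule topological_group_closure_subgroup[OF G sg])
  show "closedin (topo G) (closed_subgroup_generated G S)"
    by (simp add: closed_subgroup_generated_def)
  have "generate G S \<subseteq> closed_subgroup_generated G S"
    unfolding closed_subgroup_generated_def
    using sg by (intro closure_of_subset) (simp add: ts subgroup.subset)
  then show "S \<subseteq> closed_subgroup_generated G S" by (auto intro: generate.incl)
  show "closed_subgroup_generated G S \<subseteq> K" if "subgroup K G" "closedin (topo G) K" "S \<subseteq> K" for K
    unfolding closed_subgroup_generated_def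
    using that by (intro closure_of_minimal generate_subgroup_incl)
qed

lemma free_pro_p_incl_in:
  assumes "i \<in> I" "t \<in> carrier (T i)"
  shows "free_pro_p_incl p I T i t \<in> carrier (free_pro_p_ambient p I T)"
  using assms by (auto simp: free_pro_p_incl_def free_pro_p_ambient_simps free_pro_p_index_def hom_def Pi_iff)

lemma pro_p_group_free_pro_p_product:
  fixes p :: nat
  assumes "prime p"
  shows "pro_p_group p (free_pro_p_product p I T)"
proof -
  have A: "pro_p_group p (free_pro_p_ambient p I T)" by (rule pro_p_group_ambient[OF assms])
  then have "topological_group (free_pro_p_ambient p I T)" by (simp add: pro_p_group_def)
  then show ?thesis
    unfolding free_pro_p_product_def
    by (intro pro_p_group_closed_subgroup[OF assms A] closed_subgroup_generated_props)
       (auto simp: free_pro_p_incl_in)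
qed

lemma free_pro_p_product_generated:
  fixes p :: nat
  assumes p: "prime p" and K: "subgroup K (free_pro_p_product p I T)"
      "closedin (topo (free_pro_p_product p I T)) K"
    and incl: "\<And>i t. i \<in> I \<Longrightarrow> t \<in> carrier (T i) \<Longrightarrow> free_pro_p_incl p I T i t \<in> K"
  shows "K = carrier (free_pro_p_product p I T)"
proof
  let ?A = "free_pro_p_ambient p I T"
  let ?S = "\<Union>i\<in>I. free_pro_p_incl p I T i ` carrier (T i)"
  let ?C = "closed_subgroup_generated ?A ?S"
  have tA: "topological_group ?A" using pro_p_group_ambient[OF p] by (auto simp: pro_p_group_def)
  interpret A: group ?A using tA by (simp add: topological_group_def)
  have S: "?S \<subseteq> carrier ?A" by (auto simp: free_pro_p_incl_in)
  note C = closed_subgroup_generated_props[OF tA S]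
  have eq: "inv\<^bsub>free_pro_p_product p I T\<^esub> x = inv\<^bsub>?A\<^esub> x" if "x \<in> ?C" for x
    using A.m_inv_consistent[OF C(1) that] by (simp add: m_inv_def free_pro_p_product_def)
  have KC: "K \<subseteq> ?C" using subgroup.subset[OF K(1)] by (simp add: free_pro_p_product_def)
  have "subgroup K ?A"
  proof
    show "K \<subseteq> carrier ?A" using KC subgroup.subset[OF C(1)] by blast
    show "x \<otimes>\<^bsub>?A\<^esub> y \<in> K" if "x \<in> K" "y \<in> K" for x y
      using subgroup.m_closed[OF K(1) that] by (simp add: free_pro_p_product_def)
    show "\<one>\<^bsub>?A\<^esub> \<in> K" using subgroup.one_closed[OF K(1)] by (simp add: free_pro_p_product_def)
    show "inv\<^bsub>?A\<^esub> x \<in> K" if "x \<in> K" for x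
      using subgroup.m_inv_closed[OF K(1) that] KC that eq by auto
  qed
  moreover have "closedin (topo ?A) K"
    using K(2) C(2) by (auto simp: free_pro_p_product_def intro: closedin_trans_full)
  ultimately show "carrier (free_pro_p_product p I T) \<subseteq> K"
    using incl by (auto simp: free_pro_p_product_def dest!: C(4))
qed (use subgroup.subset[OF K(1)] in simp)

lemma free_pro_p_product_simps:
  "monoid.mult (free_pro_p_product p I T) = monoid.mult (free_pro_p_ambient p I T)"
  "one (free_pro_p_product p I T) = one (free_pro_p_ambient p I T)"
  "topo (free_pro_p_product p I T) =
     subtopology (topo (free_pro_p_ambient p I T)) (carrier (free_pro_p_product p I T))"
  by (simp_all add: free_pro_p_product_def)

lemma free_pro_p_product_subset:
  fixes p :: nat
  assumes p: "prime p"
  shows "carrier (free_pro_p_product p I T) \<subseteq> carrier (free_pro_p_ambient p I T)"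
proof -
  have "topological_group (free_pro_p_ambient p I T)"
    using pro_p_group_ambient[OF p] by (auto simp: pro_p_group_def)
  then have "subgroup (carrier (free_pro_p_product p I T)) (free_pro_p_ambient p I T)"
    unfolding free_pro_p_product_def subtopgroup_simps
    by (rule closed_subgroup_generated_props(1)) (auto simp: free_pro_p_incl_in)
  then show ?thesis by (rule subgroup.subset)
qed

lemma free_pro_p_incl_hom:
  fixes p :: nat
  assumes p: "prime p" and i: "i \<in> I" and T: "topological_group (T i)"
  shows "free_pro_p_incl p I T i \<in> cont_hom (T i) (free_pro_p_product p I T)"
proof -
  let ?A = "free_pro_p_ambient p I T"
  let ?S = "\<Union>i\<in>I. free_pro_p_incl p I T i ` carrier (T i)"
  have tA: "topological_group ?A" using pro_p_group_ambient[OF p] by (auto simp: pro_p_group_def)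
  have S: "?S \<subseteq> carrier ?A" by (auto simp: free_pro_p_incl_in)
  have inC: "free_pro_p_incl p I T i t \<in> carrier (free_pro_p_product p I T)" if "t \<in> carrier (T i)" for t
    using closed_subgroup_generated_props(3)[OF tA S] i that by (auto simp: free_pro_p_product_def)
  have "free_pro_p_incl p I T i (x \<otimes>\<^bsub>T i\<^esub> y) =
      free_pro_p_incl p I T i x \<otimes>\<^bsub>free_pro_p_product p I T\<^esub> free_pro_p_incl p I T i y"
    if "x \<in> carrier (T i)" "y \<in> carrier (T i)" for x y
    using that i
    by (auto simp: free_pro_p_product_simps free_pro_p_ambient_simps free_pro_p_incl_def fun_eq_iff
        free_pro_p_index_def hom_def)
  moreover have "continuous_map (topo (T i)) (topo ?A) (free_pro_p_incl p I T i)"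
    using i by (auto simp: free_pro_p_ambient_simps continuous_map_componentwise free_pro_p_incl_def
        free_pro_p_index_def)
  ultimately show ?thesis
    using inC T unfolding cont_hom_def free_pro_p_product_simps(3)
    by (auto simp: hom_def continuous_map_in_subtopology topological_group_def)
qed

definition dirprod_topgroup :: "'a topgroup \<Rightarrow> 'b topgroup \<Rightarrow> ('a \<times> 'b) topgroup" where
  "dirprod_topgroup G H =
     \<lparr>carrier = carrier (G \<times>\<times> H), monoid.mult = monoid.mult (G \<times>\<times> H), one = one (G \<times>\<times> H),
      topo = prod_topology (topo G) (topo H)\<rparr>"

lemma topological_group_dirprod:
  assumes G: "topological_group G" and H: "topological_group H"
  shows "topological_group (dirprod_topgroup G H)"
    and "\<And>x y. x \<in> carrier G \<Longrightarrow> y \<in> carrier H \<Longrightarrow> inv\<^bsub>dirprod_topgroup G H\<^esub> (x, y) = (inv\<^bsub>G\<^esub> x, inv\<^bsub>H\<^esub> y)"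
proof -
  let ?D = "dirprod_topgroup G H"
  have gG: "group G" and gH: "group H" using G H by (auto simp: topological_group_def)
  have g: "group ?D"
    by (rule group_cong[OF DirProd_group[OF gG gH]]) (auto simp: dirprod_topgroup_def)
  show inv: "inv\<^bsub>?D\<^esub> (x, y) = (inv\<^bsub>G\<^esub> x, inv\<^bsub>H\<^esub> y)" if "x \<in> carrier G" "y \<in> carrier H" for x y
  proof -
    have "inv\<^bsub>?D\<^esub> (x, y) = inv\<^bsub>G \<times>\<times> H\<^esub> (x, y)"
      by (rule inv_cong) (auto simp: dirprod_topgroup_def)
    then show ?thesis using inv_DirProd[OF gG gH that] by simp
  qed
  have mG: "continuous_map (prod_topology (topo ?D) (topo ?D)) (topo G) (\<lambda>z. fst (fst z) \<otimes>\<^bsub>G\<^esub> fst (snd z))"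
  proof -
    have "continuous_map (prod_topology (topo ?D) (topo ?D)) (prod_topology (topo G) (topo G)) (\<lambda>z. (fst (fst z), fst (snd z)))"
      unfolding dirprod_topgroup_def topgroup.simps
      by (intro continuous_map_pairedI
          continuous_map_compose[OF continuous_map_fst continuous_map_fst, unfolded comp_def]
          continuous_map_compose[OF continuous_map_snd continuous_map_fst, unfolded comp_def])
    then have "continuous_map (prod_topology (topo ?D) (topo ?D)) (topo G) ((\<lambda>(x, y). x \<otimes>\<^bsub>G\<^esub> y) \<circ> (\<lambda>z. (fst (fst z), fst (snd z))))"
      using G by (intro continuous_map_compose) (auto simp: topological_group_def)
    then show ?thesis by (simp add: comp_def)
  qed
  have mH: "continuous_map (prod_topology (topo ?D) (topo ?D)) (topo H) (\<lambda>z. snd (fst z) \<otimes>\<^bsub>H\<^esub> snd (snd z))"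
  proof -
    have "continuous_map (prod_topology (topo ?D) (topo ?D)) (prod_topology (topo H) (topo H)) (\<lambda>z. (snd (fst z), snd (snd z)))"
      unfolding dirprod_topgroup_def topgroup.simps
      by (intro continuous_map_pairedI
          continuous_map_compose[OF continuous_map_fst continuous_map_snd, unfolded comp_def]
          continuous_map_compose[OF continuous_map_snd continuous_map_snd, unfolded comp_def])
    then have "continuous_map (prod_topology (topo ?D) (topo ?D)) (topo H) ((\<lambda>(x, y). x \<otimes>\<^bsub>H\<^esub> y) \<circ> (\<lambda>z. (snd (fst z), snd (snd z))))"
      using H by (intro continuous_map_compose) (auto simp: topological_group_def)
    then show ?thesis by (simp add: comp_def)
  qed
  have m: "continuous_map (prod_topology (topo ?D) (topo ?D)) (topo ?D) (\<lambda>(x, y). x \<otimes>\<^bsub>?D\<^esub> y)"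
    using continuous_map_pairedI[OF mG mH]
    by (simp add: dirprod_topgroup_def case_prod_unfold mult_DirProd')
  have "continuous_map (prod_topology (topo G) (topo H)) (topo G) (m_inv G \<circ> fst)"
    using G by (intro continuous_map_compose[OF continuous_map_fst]) (simp add: topological_group_def)
  moreover have "continuous_map (prod_topology (topo G) (topo H)) (topo H) (m_inv H \<circ> snd)"
    using H by (intro continuous_map_compose[OF continuous_map_snd]) (simp add: topological_group_def)
  ultimately have "continuous_map (topo ?D) (topo ?D) (\<lambda>z. (inv\<^bsub>G\<^esub> (fst z), inv\<^bsub>H\<^esub> (snd z)))"
    by (simp add: dirprod_topgroup_def comp_def continuous_map_pairedI)
  then have "continuous_map (topo ?D) (topo ?D) (\<lambda>z. inv\<^bsub>?D\<^esub> z)"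
    by (rule continuous_map_eq) (use G H inv in \<open>auto simp: dirprod_topgroup_def topological_group_def\<close>)
  with g m G H show "topological_group ?D"
    by (auto simp: topological_group_def dirprod_topgroup_def)
qed

lemma continuous_quotient_discrete:
  fixes G (structure)
  assumes G: "topological_group G" and N: "N \<lhd> G" "openin (topo G) N"
  shows "continuous_map (topo G) (discrete_topology (rcosets N)) (\<lambda>x. N #> x)"
proof -
  interpret normal N G by fact
  have ts: "topspace (topo G) = carrier G" using G by (simp add: topological_group_def)
  have op: "openin (topo G) (N #> x)" if x: "x \<in> carrier G" for x
  proof -
    have "continuous_map (topo G) (prod_topology (topo G) (topo G)) (\<lambda>y. (y, inv x))"
      using x by (auto intro!: continuous_map_pairedI simp: ts)
    then have "continuous_map (topo G) (topo G) ((\<lambda>(x, y). x \<otimes> y) \<circ> (\<lambda>y. (y, inv x)))"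
      using G by (intro continuous_map_compose) (auto simp: topological_group_def)
    from openin_continuous_map_preimage[OF this N(2)]
    have "openin (topo G) {y \<in> carrier G. y \<otimes> inv x \<in> N}" by (simp add: ts)
    also have "{y \<in> carrier G. y \<otimes> inv x \<in> N} = N #> x"
      using x rcos_module[OF is_group x] r_coset_subset_G[OF subset x] by auto
    finally show ?thesis .
  qed
  have "openin (topo G) {x \<in> topspace (topo G). N #> x \<in> U}" for U
  proof (subst openin_subopen, clarify)
    fix x assume x: "x \<in> topspace (topo G)" "N #> x \<in> U"
    then have "N #> x \<subseteq> {x \<in> topspace (topo G). N #> x \<in> U}"
      using repr_independence[OF _ _ is_subgroup] r_coset_subset_G[OF subset] by (fastforce simp: ts)
    then show "\<exists>T. openin (topo G) T \<and> x \<in> T \<and> T \<subseteq> {x \<in> topspace (topo G). N #> x \<in> U}"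
      using op[of x] rcos_self[OF _ is_subgroup, of x] x by (auto simp: ts)
  qed
  then show ?thesis
    by (auto simp: continuous_map_def ts RCOSETS_def)
qed

lemma subgroup_equalizer:
  assumes "group_hom G H f" "group_hom G H g" "subgroup K G"
  shows "subgroup {x \<in> K. f x = g x} G"
proof -
  interpret f: group_hom G H f by fact
  interpret g: group_hom G H g by fact
  interpret K: subgroup K G by fact
  show ?thesis
    by unfold_locales (use K.subset in \<open>auto simp: subset_iff\<close>)
qed

lemma cont_hom_group_hom:
  "topological_group G \<Longrightarrow> topological_group H \<Longrightarrow> f \<in> cont_hom G H \<Longrightarrow> group_hom G H f"
  by (auto simp: topological_group_def cont_hom_def group_hom_def group_hom_axioms_def)

lemma free_pro_p_product_hom_unique:
  fixes p :: nat
  assumes p: "prime p" and H: "topological_group H" "Hausdorff_space (topo H)"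
    and f: "f \<in> cont_hom (free_pro_p_product p I T) H"
    and g: "g \<in> cont_hom (free_pro_p_product p I T) H"
    and eq: "\<And>i t. i \<in> I \<Longrightarrow> t \<in> carrier (T i) \<Longrightarrow>
      f (free_pro_p_incl p I T i t) = g (free_pro_p_incl p I T i t)"
    and T: "\<And>i. i \<in> I \<Longrightarrow> topological_group (T i)"
    and x: "x \<in> carrier (free_pro_p_product p I T)"
  shows "f x = g x"
proof -
  let ?P = "free_pro_p_product p I T"
  have P: "topological_group ?P" using pro_p_group_free_pro_p_product[OF p] by (auto simp: pro_p_group_def)
  interpret f: group_hom ?P H f using P H f by (intro cont_hom_group_hom)
  interpret g: group_hom ?P H g using P H g by (intro cont_hom_group_hom)
  have ts: "topspace (topo ?P) = carrier ?P" using P by (simp add: topological_group_def)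
  have "{x \<in> carrier ?P. f x = g x} = carrier ?P"
  proof (rule free_pro_p_product_generated[OF p])
    show "subgroup {x \<in> carrier ?P. f x = g x} ?P"
      by (rule subgroup_equalizer[OF f.group_hom_axioms g.group_hom_axioms f.G.subgroup_self])
    show "closedin (topo ?P) {x \<in> carrier ?P. f x = g x}"
      using closedin_continuous_maps_eq[OF H(2), of "topo ?P" f g] f g by (simp add: ts cont_hom_def)
    show "free_pro_p_incl p I T i t \<in> {x \<in> carrier ?P. f x = g x}" if "i \<in> I" "t \<in> carrier (T i)" for i t
      using that eq free_pro_p_incl_hom[where T = T and I = I, OF p that(1) T[OF that(1)]] by (auto simp: cont_hom_def hom_def)
  qed
  then show ?thesis using x by blast
qed

lemma free_pro_p_product_hom_exists:
  fixes p :: nat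
  assumes p: "prime p" and H: "pro_p_group p H"
    and T: "\<And>i. i \<in> I \<Longrightarrow> topological_group (T i)"
    and f: "\<And>i. i \<in> I \<Longrightarrow> f i \<in> cont_hom (T i) H"
  shows "\<exists>\<phi>. \<phi> \<in> cont_hom (free_pro_p_product p I T) H \<and>
    (\<forall>i\<in>I. \<forall>t\<in>carrier (T i). \<phi> (free_pro_p_incl p I T i t) = f i t)"
proof -
  let ?P = "free_pro_p_product p I T" and ?\<iota> = "free_pro_p_incl p I T"
  let ?D = "dirprod_topgroup ?P H"
  have ppP: "pro_p_group p ?P" by (rule pro_p_group_free_pro_p_product[OF p])
  then have tP: "topological_group ?P" and hP: "Hausdorff_space (topo ?P)" and cP: "compact_space (topo ?P)"
    by (auto simp: pro_p_group_def)
  have tH: "topological_group H" and hH: "Hausdorff_space (topo H)" and cH: "compact_space (topo H)"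
    using H by (auto simp: pro_p_group_def)
  have tD: "topological_group ?D" by (rule topological_group_dirprod(1)[OF tP tH])
  interpret P: group ?P using tP by (simp add: topological_group_def)
  interpret H: group H using tH by (simp add: topological_group_def)
  interpret D: group ?D using tD by (simp add: topological_group_def)
  have tsP: "topspace (topo ?P) = carrier ?P" using tP by (simp add: topological_group_def)
  have D: "carrier ?D = carrier ?P \<times> carrier H" "\<And>x y. x \<otimes>\<^bsub>?D\<^esub> y = (fst x \<otimes>\<^bsub>?P\<^esub> fst y, snd x \<otimes>\<^bsub>H\<^esub> snd y)"
     "one ?D = (one ?P, one H)" "topo ?D = prod_topology (topo ?P) (topo H)"
    by (simp_all add: dirprod_topgroup_def mult_DirProd')
  have inP: "?\<iota> i t \<in> carrier ?P" if "i \<in> I" "t \<in> carrier (T i)" for i t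
    using that free_pro_p_incl_hom[where T = T and I = I, OF p that(1) T[OF that(1)]] by (auto simp: cont_hom_def hom_def)
  have inH: "f i t \<in> carrier H" if "i \<in> I" "t \<in> carrier (T i)" for i t
    using that f[OF that(1)] by (auto simp: cont_hom_def hom_def)
  define S where "S = (\<Union>i\<in>I. (\<lambda>t. (?\<iota> i t, f i t)) ` carrier (T i))"
  define \<Gamma> where "\<Gamma> = closed_subgroup_generated ?D S"
  have S: "S \<subseteq> carrier ?D" by (auto simp: S_def D inP inH)
  note \<Gamma> = closed_subgroup_generated_props[OF tD S, folded \<Gamma>_def]
  have \<Gamma>sub: "\<Gamma> \<subseteq> carrier ?D" using subgroup.subset[OF \<Gamma>(1)] .
  have fst_hom: "group_hom ?D ?P fst" and snd_hom: "group_hom ?D H snd"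
    by unfold_locales (auto simp: hom_def D)
  have comp: "compactin (topo ?D) \<Gamma>"
    using \<Gamma>(2) cP cH by (intro closedin_compact_space) (auto simp: D compact_space_prod_topology)
  have onto: "fst ` \<Gamma> = carrier ?P"
  proof (rule free_pro_p_product_generated[OF p])
    show "subgroup (fst ` \<Gamma>) ?P" by (rule group_hom.subgroup_img_is_subgroup[OF fst_hom \<Gamma>(1)])
    show "closedin (topo ?P) (fst ` \<Gamma>)"
      using image_compactin[OF comp, of "topo ?P" fst] hP
      by (intro compactin_imp_closedin) (auto simp: D continuous_map_fst)
    show "?\<iota> i t \<in> fst ` \<Gamma>" if "i \<in> I" "t \<in> carrier (T i)" for i t
      using that \<Gamma>(3) by (force simp: S_def)
  qed
  have ker: "u = \<one>\<^bsub>H\<^esub>" if u: "(\<one>\<^bsub>?P\<^esub>, u) \<in> \<Gamma>" for u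
  proof (rule ccontr)
    assume ne: "u \<noteq> \<one>\<^bsub>H\<^esub>"
    have uH: "u \<in> carrier H" using u \<Gamma>sub by (auto simp: D)
    have "closedin (topo H) {u}"
      using uH hH tH by (auto simp: topological_group_def closedin_Hausdorff_sing_eq)
    then have "openin (topo H) (carrier H - {u})"
      using tH by (simp add: topological_group_def closedin_def)
    then obtain N k where N: "N \<lhd> H" "openin (topo H) N" "card (rcosets\<^bsub>H\<^esub> N) = p ^ k" "N \<subseteq> carrier H - {u}"
      using H ne unfolding pro_p_group_def by (metis DiffI H.one_closed singletonD)
    interpret N: normal N H by fact
    interpret Q: group "H Mod N" by (rule N.factorgroup_is_group)
    have "finite (rcosets\<^bsub>H\<^esub> N)"
      using N(3) p by (intro card_ge_0_finite) (simp add: prime_gt_0_nat)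
    from finite_imp_inj_to_nat_seg[OF this]
    obtain e :: "_ \<Rightarrow> nat" where e: "inj_on e (rcosets\<^bsub>H\<^esub> N)"
      by auto
    have e': "inj_on e (carrier (H Mod N))" using e by (simp add: FactGroup_def)
    define F where "F = flatten (H Mod N) e"
    define q where "q x = e (N #>\<^bsub>H\<^esub> x)" for x
    interpret F: group F unfolding F_def by (rule flatten_set_group[OF Q.is_group e'])
    have cF: "carrier F = e ` (rcosets\<^bsub>H\<^esub> N)" by (simp add: F_def flatten_def FactGroup_def)
    have q: "q \<in> hom H F"
      using hom_compose[OF N.r_coset_hom_Mod flatten_set_group_hom[OF Q.is_group e']]
      by (simp add: F_def q_def[abs_def] comp_def)
    have "continuous_map (discrete_topology (rcosets\<^bsub>H\<^esub> N)) (discrete_topology (carrier F)) e"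
      by (auto simp: cF)
    from continuous_map_compose[OF continuous_quotient_discrete[OF tH N(1,2)] this]
    have qc: "continuous_map (topo H) (discrete_topology (carrier F)) q"
      by (simp add: comp_def q_def[abs_def])
    define k' where "k' = (F, \<lambda>i. q \<circ> f i)"
    have "card (carrier F) = p ^ k" using N(3) e by (simp add: cF card_image)
    then have k': "k' \<in> free_pro_p_index p I T"
      using f q qc F.is_group
      by (auto simp: k'_def free_pro_p_index_def cont_hom_def intro: hom_compose continuous_map_compose)
    have c1: "continuous_map (topo ?P) (discrete_topology (carrier F)) (\<lambda>x. x k')"
      unfolding free_pro_p_product_simps(3) free_pro_p_ambient_simps(4)
      using continuous_map_product_coordinates[OF k', of "\<lambda>k. discrete_topology (carrier (fst k))"]
      by (intro continuous_map_from_subtopology) (simp add: k'_def)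
    have "x k' \<in> carrier F" if "x \<in> carrier ?P" for x
      using that k' subsetD[OF free_pro_p_product_subset[OF p]]
      by (force simp: free_pro_p_ambient_simps k'_def dest: PiE_mem)
    moreover have "(x \<otimes>\<^bsub>?P\<^esub> y) k' = x k' \<otimes>\<^bsub>F\<^esub> y k'" for x y
      using k' by (simp add: free_pro_p_product_simps free_pro_p_ambient_simps) (simp add: k'_def)
    ultimately have pr: "(\<lambda>x. x k') \<in> hom ?P F"
      by (simp add: hom_def)
    have h1: "group_hom ?D F (\<lambda>z. fst z k')"
      using hom_compose[OF group_hom.homh[OF fst_hom] pr] by unfold_locales (simp add: comp_def)
    have h2: "group_hom ?D F (\<lambda>z. q (snd z))"
      using hom_compose[OF group_hom.homh[OF snd_hom] q] by unfold_locales (simp add: comp_def)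
    have "\<Gamma> \<subseteq> {z \<in> carrier ?D. fst z k' = q (snd z)}"
    proof (rule \<Gamma>(4))
      show "subgroup {z \<in> carrier ?D. fst z k' = q (snd z)} ?D"
        by (rule subgroup_equalizer[OF h1 h2 D.subgroup_self])
      have "continuous_map (topo ?D) (discrete_topology (carrier F)) (\<lambda>z. fst z k')"
        using continuous_map_compose[OF continuous_map_fst c1] by (simp add: D comp_def)
      moreover have "continuous_map (topo ?D) (discrete_topology (carrier F)) (\<lambda>z. q (snd z))"
        using continuous_map_compose[OF continuous_map_snd qc] by (simp add: D comp_def)
      ultimately show "closedin (topo ?D) {z \<in> carrier ?D. fst z k' = q (snd z)}"
        using closedin_continuous_maps_eq[of "discrete_topology (carrier F)" "topo ?D"] tD
        by (auto simp: topological_group_def)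
      show "S \<subseteq> {z \<in> carrier ?D. fst z k' = q (snd z)}"
        using S k' by (auto simp: S_def free_pro_p_incl_def) (simp_all add: k'_def)
    qed
    then have "\<one>\<^bsub>?P\<^esub> k' = q u" using u by auto
    moreover have "\<one>\<^bsub>?P\<^esub> k' = q \<one>\<^bsub>H\<^esub>"
      using hom_one[OF pr P.is_group F.is_group] hom_one[OF q H.is_group F.is_group] by simp
    ultimately have "N #>\<^bsub>H\<^esub> u = N #>\<^bsub>H\<^esub> \<one>\<^bsub>H\<^esub>"
      using inj_onD[OF e] uH by (auto simp: q_def RCOSETS_def)
    then have "u \<in> N"
      using H.rcos_self[OF uH N.is_subgroup] H.coset_mult_one[OF N.subset] by simp
    then show False using N(4) by blast
  qed
  have inj: "inj_on fst \<Gamma>"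
  proof (rule inj_onI)
    fix a b assume ab: "a \<in> \<Gamma>" "b \<in> \<Gamma>" "fst a = fst b"
    then have abD: "a \<in> carrier ?D" "b \<in> carrier ?D" using \<Gamma>sub by auto
    have "a \<otimes>\<^bsub>?D\<^esub> inv\<^bsub>?D\<^esub> b \<in> \<Gamma>"
      using ab \<Gamma>(1) by (simp add: subgroup.m_closed subgroup.m_inv_closed)
    moreover have "a \<otimes>\<^bsub>?D\<^esub> inv\<^bsub>?D\<^esub> b = (\<one>\<^bsub>?P\<^esub>, snd a \<otimes>\<^bsub>H\<^esub> inv\<^bsub>H\<^esub> snd b)"
      using abD ab(3) topological_group_dirprod(2)[OF tP tH, of "fst b" "snd b"] by (auto simp: D)
    ultimately have "snd a \<otimes>\<^bsub>H\<^esub> inv\<^bsub>H\<^esub> snd b = \<one>\<^bsub>H\<^esub>" using ker by metis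
    then have "snd a = snd b" using abD by (metis D(1) H.inv_closed H.inv_equality H.inv_inv mem_Times_iff)
    with ab(3) show "a = b" by (simp add: prod_eq_iff)
  qed
  have ts\<Gamma>: "topspace (subtopology (topo ?D) \<Gamma>) = \<Gamma>"
    using \<Gamma>sub tD by (auto simp: topological_group_def)
  have "homeomorphic_map (subtopology (topo ?D) \<Gamma>) (topo ?P) fst"
  proof (rule continuous_imp_homeomorphic_map)
    show "continuous_map (subtopology (topo ?D) \<Gamma>) (topo ?P) fst"
      by (auto simp: D intro: continuous_map_from_subtopology continuous_map_fst)
    show "compact_space (subtopology (topo ?D) \<Gamma>)" using comp by (simp add: compactin_subspace)
  qed (use hP onto inj in \<open>simp_all only: ts\<Gamma> tsP\<close>)
  then obtain g where g: "homeomorphic_maps (subtopology (topo ?D) \<Gamma>) (topo ?P) fst g"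
    by (auto simp: homeomorphic_map_maps)
  have gc: "continuous_map (topo ?P) (topo ?D) g" and g\<Gamma>: "\<And>x. x \<in> carrier ?P \<Longrightarrow> g x \<in> \<Gamma> \<and> fst (g x) = x"
    and gf: "\<And>z. z \<in> \<Gamma> \<Longrightarrow> g (fst z) = z"
    using g ts\<Gamma> tsP unfolding homeomorphic_maps_def continuous_map_in_subtopology by auto
  have "snd \<circ> g \<in> cont_hom ?P H"
  proof -
    have "continuous_map (topo ?P) (topo H) (snd \<circ> g)"
      using gc by (rule continuous_map_compose) (simp add: D continuous_map_snd)
    moreover have "snd (g x) \<in> carrier H" if "x \<in> carrier ?P" for x
      using g\<Gamma>[OF that] \<Gamma>sub by (auto simp: D)
    moreover have "snd (g (x \<otimes>\<^bsub>?P\<^esub> y)) = snd (g x) \<otimes>\<^bsub>H\<^esub> snd (g y)" if "x \<in> carrier ?P" "y \<in> carrier ?P" for x y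
    proof -
      have "g x \<otimes>\<^bsub>?D\<^esub> g y \<in> \<Gamma>" using g\<Gamma> that \<Gamma>(1) by (simp add: subgroup.m_closed)
      from gf[OF this] show ?thesis using g\<Gamma> that by (simp add: D)
    qed
    ultimately show ?thesis by (auto simp: cont_hom_def hom_def)
  qed
  moreover have "(snd \<circ> g) (?\<iota> i t) = f i t" if "i \<in> I" "t \<in> carrier (T i)" for i t
  proof -
    have "(?\<iota> i t, f i t) \<in> \<Gamma>" using that \<Gamma>(3) by (auto simp: S_def)
    from gf[OF this] show ?thesis by simp
  qed
  ultimately show ?thesis by blast
qed

theorem free_pro_p_product_universal:
  fixes p :: nat
  assumes p: "prime p" and H: "pro_p_group p H"
    and T: "\<And>i. i \<in> I \<Longrightarrow> pro_p_group p (T i)"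
    and f: "\<And>i. i \<in> I \<Longrightarrow> f i \<in> cont_hom (T i) H"
  shows "\<exists>!\<phi>. \<phi> \<in> extensional (carrier (free_pro_p_product p I T)) \<and>
    \<phi> \<in> cont_hom (free_pro_p_product p I T) H \<and>
    (\<forall>i\<in>I. \<forall>t\<in>carrier (T i). \<phi> (free_pro_p_incl p I T i t) = f i t)"
proof -
  let ?P = "free_pro_p_product p I T"
  have T': "topological_group (T i)" if "i \<in> I" for i using T[OF that] by (simp add: pro_p_group_def)
  have tP: "topological_group ?P" using pro_p_group_free_pro_p_product[OF p] by (auto simp: pro_p_group_def)
  then have tsP: "topspace (topo ?P) = carrier ?P" by (simp add: topological_group_def)
  interpret P: group ?P using tP by (simp add: topological_group_def)
  have tH: "topological_group H" "Hausdorff_space (topo H)" using H by (auto simp: pro_p_group_def)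
  obtain \<phi> where \<phi>: "\<phi> \<in> cont_hom ?P H" "\<And>i t. i \<in> I \<Longrightarrow> t \<in> carrier (T i) \<Longrightarrow> \<phi> (free_pro_p_incl p I T i t) = f i t"
    using free_pro_p_product_hom_exists[where f = f and I = I and T = T, OF p H T' f] by auto
  have inP: "free_pro_p_incl p I T i t \<in> carrier ?P" if "i \<in> I" "t \<in> carrier (T i)" for i t
    using that free_pro_p_incl_hom[where T = T and I = I, OF p that(1) T'[OF that(1)]] by (auto simp: cont_hom_def hom_def)
  have "continuous_map (topo ?P) (topo H) (restrict \<phi> (carrier ?P))"
    using \<phi>(1) by (auto simp: cont_hom_def tsP intro: continuous_map_eq[of _ _ \<phi>])
  then have "restrict \<phi> (carrier ?P) \<in> cont_hom ?P H"
    using \<phi>(1) by (auto simp: cont_hom_def hom_def)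
  moreover have "\<phi>1 = \<phi>2" if e: "\<phi>1 \<in> extensional (carrier ?P)" "\<phi>2 \<in> extensional (carrier ?P)"
     and c1: "\<phi>1 \<in> cont_hom ?P H" and c2: "\<phi>2 \<in> cont_hom ?P H"
     and e1: "\<forall>i\<in>I. \<forall>t\<in>carrier (T i). \<phi>1 (free_pro_p_incl p I T i t) = f i t"
     and e2: "\<forall>i\<in>I. \<forall>t\<in>carrier (T i). \<phi>2 (free_pro_p_incl p I T i t) = f i t" for \<phi>1 \<phi>2
  proof (rule extensionalityI[OF e])
    show "\<phi>1 x = \<phi>2 x" if "x \<in> carrier ?P" for x
      by (rule free_pro_p_product_hom_unique[where T = T and I = I, OF p tH c1 c2 _ T' that])
        (simp_all add: e1 e2)
  qed
  ultimately show ?thesis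
    using \<phi>(2) inP by (intro ex1I[of _ "restrict \<phi> (carrier ?P)"]) auto
qed

definition induced_hom ::
    "nat \<Rightarrow> 'i set \<Rightarrow> ('i \<Rightarrow> 'a topgroup) \<Rightarrow> 'h topgroup \<Rightarrow> ('i \<Rightarrow> 'a \<Rightarrow> 'h) \<Rightarrow>
       (nat monoid \<times> ('i \<Rightarrow> 'a \<Rightarrow> nat) \<Rightarrow> nat) \<Rightarrow> 'h" where
  "induced_hom p I T H f =
     (THE \<phi>. \<phi> \<in> extensional (carrier (free_pro_p_product p I T)) \<and>
        \<phi> \<in> cont_hom (free_pro_p_product p I T) H \<and>
        (\<forall>i\<in>I. \<forall>t\<in>carrier (T i). \<phi> (free_pro_p_incl p I T i t) = f i t))"

lemma induced_hom_props:
  fixes p :: nat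
  assumes p: "prime p" and H: "pro_p_group p H"
    and T: "\<And>i. i \<in> I \<Longrightarrow> pro_p_group p (T i)"
    and f: "\<And>i. i \<in> I \<Longrightarrow> f i \<in> cont_hom (T i) H"
  shows "induced_hom p I T H f \<in> cont_hom (free_pro_p_product p I T) H"
    and "\<And>i t. i \<in> I \<Longrightarrow> t \<in> carrier (T i) \<Longrightarrow>
      induced_hom p I T H f (free_pro_p_incl p I T i t) = f i t"
  using theI'[OF free_pro_p_product_universal[where T = T and I = I and f = f, OF p H T f], folded induced_hom_def]
  by blast+

section \<open>Linking structures\<close>

text \<open>All groups \<open>Z i\<close> live on one type \<open>'z\<close>; this is no restriction, as a family of groups
  can be placed on their disjoint union. \<open>ls_T L i\<close> is the set of elements of the closed normal
  subgroup \<open>T i\<close>, and \<open>ls_sec L i\<close> the section of the projection from \<open>Z i\<close> to \<open>Z i / T i\<close>.\<close>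

record ('g, 'u, 'i, 'z) linking_data =
  ls_G :: "'g topgroup"
  ls_U :: "'u topgroup"
  ls_I :: "'i set"
  ls_Z :: "'i \<Rightarrow> 'z topgroup"
  ls_T :: "'i \<Rightarrow> 'z set"
  ls_sec :: "'i \<Rightarrow> 'z set \<Rightarrow> 'z"
  ls_lam :: "'i \<Rightarrow> 'z \<Rightarrow> 'g"
  ls_pi :: "'i \<Rightarrow> 'z \<Rightarrow> 'u"

definition ls_Tgrp :: "('g, 'u, 'i, 'z) linking_data \<Rightarrow> 'i \<Rightarrow> 'z topgroup" where
  "ls_Tgrp L i = subtopgroup (ls_Z L i) (ls_T L i)"

definition ls_Zbar :: "('g, 'u, 'i, 'z) linking_data \<Rightarrow> 'i \<Rightarrow> 'z set" where
  "ls_Zbar L i = ls_sec L i ` carrier (quotient_topgroup (ls_Z L i) (ls_T L i))"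

definition linking_structure :: "nat \<Rightarrow> ('g, 'u, 'i, 'z) linking_data \<Rightarrow> bool" where
  "linking_structure p L \<longleftrightarrow>
     pro_p_group p (ls_G L) \<and> pro_p_group p (ls_U L) \<and>
     (\<forall>i\<in>ls_I L.
        pro_p_group p (ls_Z L i) \<and>
        ls_T L i \<lhd> ls_Z L i \<and> closedin (topo (ls_Z L i)) (ls_T L i) \<and>
        ls_sec L i \<in> cont_hom (quotient_topgroup (ls_Z L i) (ls_T L i)) (ls_Z L i) \<and>
        (\<forall>c\<in>carrier (quotient_topgroup (ls_Z L i) (ls_T L i)).
           quotient_proj (ls_Z L i) (ls_T L i) (ls_sec L i c) = c) \<and>
        ls_lam L i \<in> cont_hom (ls_Z L i) (ls_G L) \<and>
        ls_pi L i \<in> cont_hom (ls_Tgrp L i) (ls_U L)) \<and>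
     closed_subgroup_generated (ls_G L) (\<Union>i\<in>ls_I L. ls_lam L i ` ls_T L i) = carrier (ls_G L)"

definition globalization :: "('g, 'u, 'i, 'z) linking_data \<Rightarrow> ('g \<Rightarrow> 'u) \<Rightarrow> bool" where
  "globalization L \<rho> \<longleftrightarrow>
     \<rho> \<in> cont_hom (ls_G L) (ls_U L) \<and>
     (\<forall>i\<in>ls_I L. \<forall>t\<in>ls_T L i. \<rho> (ls_lam L i t) = ls_pi L i t)"

definition quotient_linking ::
    "('g, 'u, 'i, 'z) linking_data \<Rightarrow> 'u set \<Rightarrow> ('g, 'u set, 'i, 'z) linking_data" where
  "quotient_linking L V =
     \<lparr>ls_G = ls_G L, ls_U = quotient_topgroup (ls_U L) V, ls_I = ls_I L, ls_Z = ls_Z L,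
      ls_T = ls_T L, ls_sec = ls_sec L, ls_lam = ls_lam L,
      ls_pi = (\<lambda>i. quotient_proj (ls_U L) V \<circ> ls_pi L i)\<rparr>"

abbreviation ls_That where
  "ls_That p L \<equiv> free_pro_p_product p (ls_I L) (ls_Tgrp L)"

definition ls_lam_hat where
  "ls_lam_hat p L = induced_hom p (ls_I L) (ls_Tgrp L) (ls_G L) (ls_lam L)"

definition ls_pi_hat where
  "ls_pi_hat p L = induced_hom p (ls_I L) (ls_Tgrp L) (ls_U L) (ls_pi L)"

definition ls_Zhat where
  "ls_Zhat p L i = {x \<in> carrier (ls_That p L). ls_lam_hat p L x \<in> ls_lam L i ` ls_Zbar L i}"

definition has_link_type :: "nat \<Rightarrow> ('g, 'u, 'i, 'z) linking_data \<Rightarrow> 'u set \<Rightarrow> bool" where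
  "has_link_type p L V \<longleftrightarrow>
     (\<exists>S. S \<subseteq> (\<Union>i\<in>ls_I L.
              kernel (ls_That p L) (ls_U L) (ls_pi_hat p L) <#>\<^bsub>ls_That p L\<^esub>
              closed_commutator_subgroup (ls_That p L)
                {x \<in> carrier (ls_That p L). ls_pi_hat p L x \<in> centralizer (ls_U L) V}
                (ls_Zhat p L i)) \<and>
        kernel (ls_That p L) (ls_G L) (ls_lam_hat p L) =
          closed_normal_subgroup_generated (ls_That p L) S)"

end

theory Submission
  imports Defs
begin

text \<open>Composing with the projection \<open>pr\<close> from \<open>U\<close> to \<open>U/V\<close> turns globalizations into globalizations, and
  \<open>pr\<close> kills exactly \<open>V\<close>; this is the whole content of the first part and of the last claim of the
  second. A globalization is determined by its values on the topological generators \<open>\<lambda>\<^sub>i(T\<^sub>i)\<close> of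
  \<open>G\<close>, so a lift is unique. It remains to construct one.

  Let \<open>\<lambda>\<close> and \<open>\<pi>\<close> be the homomorphisms from the free product of the \<open>T\<^sub>i\<close> to \<open>G\<close> and \<open>U\<close>. The first
  one is onto, and a continuous surjection of compact Hausdorff groups is a quotient map, so \<open>\<pi>\<close>
  factors through a continuous homomorphism \<open>\<rho>\<close> on \<open>G\<close> as soon as \<open>Ker \<lambda> \<subseteq> Ker \<pi>\<close>
  (\<open>cont_hom_factor\<close>); this \<open>\<rho>\<close> is the globalization sought.

  The given globalization \<open>\<rho>'\<close> modulo \<open>V\<close> yields this inclusion of kernels. The homomorphisms
  \<open>pr \<circ> \<pi>\<close> and \<open>\<rho>' \<circ> \<lambda>\<close> agree on every \<open>T\<^sub>i\<close>, and \<open>U/V\<close> is Hausdorff, so they agree on the whole free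
  product (\<open>quotient_globalization_lam_hat\<close>); this also makes \<open>\<rho>\<close> a lift of \<open>\<rho>'\<close>. If \<open>\<lambda>(z)\<close> lies in
  the image under \<open>\<lambda>\<^sub>i\<close> of the complement of \<open>T\<^sub>i\<close> in \<open>Z\<^sub>i\<close>, where \<open>\<rho>'\<close> is trivial, then \<open>\<pi>(z) \<in> V\<close>,
  and hence \<open>\<pi>(z)\<close> commutes with \<open>\<pi>(a)\<close> whenever \<open>\<pi>(a)\<close> centralizes \<open>V\<close>. So \<open>\<pi>\<close> kills the
  commutators of a \<open>V\<close>-link type (\<open>closed_commutator_subgroup_in_kernel\<close>), and then also \<open>Ker \<lambda>\<close>,
  which is generated as a closed normal subgroup by products of such elements with elements of
  \<open>Ker \<pi>\<close> (\<open>link_type_kernel_subset\<close>).\<close>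

section \<open>Quotients of topological groups\<close>

lemma quotient_topgroup_group:
  assumes "N \<lhd> G"
  shows "group (quotient_topgroup G N)"
  by (rule group_cong[OF normal.factorgroup_is_group[OF assms]]) (simp_all add: quotient_topgroup_def)

lemma topspace_quotient_topgroup:
  assumes tG: "topological_group G" and N: "N \<lhd> G"
  shows "topspace (topo (quotient_topgroup G N)) = carrier (quotient_topgroup G N)"
proof -
  interpret normal N G by fact
  have "topspace (topo G) = carrier G" using tG by (simp add: topological_group_def)
  then have "openin (topo G) (\<Union>(carrier (G Mod N)))"
    using rcosets_part_G[OF is_subgroup] openin_topspace[of "topo G"] by (simp add: FactGroup_def)
  then have "openin (topo (quotient_topgroup G N)) (carrier (G Mod N))"
    using N by (simp add: openin_quotient_topgroup)
  moreover have "\<X> \<subseteq> carrier (G Mod N)" if "openin (topo (quotient_topgroup G N)) \<X>" for \<X>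
    using that N by (simp add: openin_quotient_topgroup)
  ultimately have "topspace (topo (quotient_topgroup G N)) = carrier (G Mod N)"
    by (meson openin_subset openin_topspace subset_antisym)
  then show ?thesis by (simp add: quotient_topgroup_def)
qed

lemma quotient_proj_in_carrier:
  assumes "N \<lhd> G" "x \<in> carrier G"
  shows "quotient_proj G N x \<in> carrier (quotient_topgroup G N)"
  using assms by (auto simp: quotient_topgroup_def quotient_proj_def FactGroup_def RCOSETS_def)

lemma quotient_proj_eq_iff:
  fixes G (structure)
  assumes N: "N \<lhd> G" and x: "x \<in> carrier G" and y: "y \<in> carrier G"
  shows "quotient_proj G N x = quotient_proj G N y \<longleftrightarrow> x \<otimes> inv y \<in> N"
proof -
  interpret normal N G by fact
  have "quotient_proj G N x = quotient_proj G N y \<longleftrightarrow> x \<in> N #> y"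
    using rcos_self[OF x is_subgroup] repr_independence[OF _ y is_subgroup]
    by (auto simp: quotient_proj_def)
  then show ?thesis using rcos_module[OF is_group y x] by simp
qed

lemma quotient_proj_eq_one_iff:
  fixes G (structure)
  assumes N: "N \<lhd> G" and x: "x \<in> carrier G"
  shows "quotient_proj G N x = \<one>\<^bsub>quotient_topgroup G N\<^esub> \<longleftrightarrow> x \<in> N"
proof -
  interpret normal N G by fact
  show ?thesis
    using coset_join1[OF _ x is_subgroup] coset_join2[OF x is_subgroup]
    by (auto simp: quotient_proj_def quotient_topgroup_def FactGroup_def)
qed

lemma quotient_proj_cont_hom:
  assumes tG: "topological_group G" and N: "N \<lhd> G"
  shows "quotient_proj G N \<in> cont_hom G (quotient_topgroup G N)"
proof -
  interpret normal N G by fact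
  have ts: "topspace (topo G) = carrier G" using tG by (simp add: topological_group_def)
  have "quotient_proj G N \<in> hom G (quotient_topgroup G N)"
    using r_coset_hom_Mod by (simp add: hom_def quotient_topgroup_def quotient_proj_def Pi_iff)
  moreover have "openin (topo G) {x \<in> carrier G. quotient_proj G N x \<in> \<X>}"
    if "openin (topo (quotient_topgroup G N)) \<X>" for \<X>
  proof -
    have \<X>: "\<X> \<subseteq> rcosets\<^bsub>G\<^esub> N" "openin (topo G) (\<Union>\<X>)"
      using that N by (simp_all add: openin_quotient_topgroup FactGroup_def)
    have "{x \<in> carrier G. quotient_proj G N x \<in> \<X>} = \<Union>\<X>"
    proof (intro equalityI subsetI)
      fix x assume "x \<in> {x \<in> carrier G. quotient_proj G N x \<in> \<X>}"
      then show "x \<in> \<Union>\<X>"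
        using rcos_self[OF _ is_subgroup, of x] by (auto simp: quotient_proj_def)
    next
      fix x assume "x \<in> \<Union>\<X>"
      then obtain y where y: "y \<in> carrier G" "N #>\<^bsub>G\<^esub> y \<in> \<X>" "x \<in> N #>\<^bsub>G\<^esub> y"
        using \<X>(1) by (auto simp: RCOSETS_def)
      then show "x \<in> {x \<in> carrier G. quotient_proj G N x \<in> \<X>}"
        using repr_independence[OF y(3,1) is_subgroup] r_coset_subset_G[OF subset y(1)]
        by (auto simp: quotient_proj_def)
    qed
    with \<X>(2) show ?thesis by simp
  qed
  ultimately show ?thesis
    using quotient_proj_in_carrier[OF N]
    by (auto simp: cont_hom_def continuous_map_def ts topspace_quotient_topgroup[OF tG N])
qed

lemma openin_quotient_proj_image:
  fixes G (structure)
  assumes tG: "topological_group G" and N: "N \<lhd> G" and A: "openin (topo G) A"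
  shows "openin (topo (quotient_topgroup G N)) (quotient_proj G N ` A)"
proof -
  interpret normal N G by fact
  have ts: "topspace (topo G) = carrier G" using tG by (simp add: topological_group_def)
  have AG: "A \<subseteq> carrier G" using openin_subset[OF A] by (simp add: ts)
  \<comment> \<open>The saturation of \<open>A\<close> is the union of its translates by elements of \<open>N\<close>.\<close>
  have sat: "\<Union>(quotient_proj G N ` A) = (\<Union>n\<in>N. {z \<in> carrier G. n \<otimes> z \<in> A})"
  proof (intro equalityI subsetI)
    fix z assume "z \<in> \<Union>(quotient_proj G N ` A)"
    then obtain a n where a: "a \<in> A" "n \<in> N" "z = n \<otimes> a"
      by (auto simp: quotient_proj_def r_coset_def)
    then have "a \<in> carrier G" "n \<in> carrier G" using AG subset by auto
    with a have "inv n \<in> N" "z \<in> carrier G" "inv n \<otimes> z = a"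
      by (simp_all add: m_assoc[symmetric])
    with a(1) show "z \<in> (\<Union>n\<in>N. {z \<in> carrier G. n \<otimes> z \<in> A})" by auto
  next
    fix z assume "z \<in> (\<Union>n\<in>N. {z \<in> carrier G. n \<otimes> z \<in> A})"
    then obtain n where n: "n \<in> N" "z \<in> carrier G" "n \<otimes> z \<in> A" by auto
    then have "n \<in> carrier G" using subset by auto
    with n have "inv n \<in> N" "z = inv n \<otimes> (n \<otimes> z)" by (simp_all add: m_assoc[symmetric])
    with n(3) show "z \<in> \<Union>(quotient_proj G N ` A)"
      by (auto simp: quotient_proj_def r_coset_def)
  qed
  have "openin (topo G) {z \<in> carrier G. n \<otimes> z \<in> A}" if n: "n \<in> N" for n
  proof -
    have "continuous_map (topo G) (prod_topology (topo G) (topo G)) (\<lambda>y. (n, y))"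
      using n subset by (auto intro!: continuous_map_pairedI simp: ts)
    then have "continuous_map (topo G) (topo G) ((\<lambda>(x, y). x \<otimes> y) \<circ> (\<lambda>y. (n, y)))"
      using tG by (intro continuous_map_compose) (auto simp: topological_group_def)
    from openin_continuous_map_preimage[OF this A] show ?thesis by (simp add: ts)
  qed
  then have "openin (topo G) (\<Union>(quotient_proj G N ` A))" unfolding sat by blast
  moreover have "quotient_proj G N ` A \<subseteq> carrier (G Mod N)"
    using quotient_proj_in_carrier[OF N] AG by (auto simp: quotient_topgroup_def)
  ultimately show ?thesis using N by (simp add: openin_quotient_topgroup)
qed

text \<open>If \<open>x \<otimes> inv y\<close> lies in the open complement of \<open>N\<close>, then so does \<open>a \<otimes> inv b\<close> for all \<open>a\<close> near \<open>x\<close>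
  and \<open>b\<close> near \<open>y\<close>. The projection is open, so the images of these two neighbourhoods separate the
  cosets of \<open>x\<close> and \<open>y\<close>.\<close>

lemma Hausdorff_space_quotient_topgroup:
  fixes G (structure)
  assumes tG: "topological_group G" and N: "N \<lhd> G" and cN: "closedin (topo G) N"
  shows "Hausdorff_space (topo (quotient_topgroup G N))"
  unfolding Hausdorff_space_def
proof (intro allI impI)
  interpret normal N G by fact
  have ts: "topspace (topo G) = carrier G" using tG by (simp add: topological_group_def)
  let ?q = "quotient_proj G N" and ?GG = "prod_topology (topo G) (topo G)"
  fix X Y
  assume "X \<in> topspace (topo (quotient_topgroup G N)) \<and>
    Y \<in> topspace (topo (quotient_topgroup G N)) \<and> X \<noteq> Y"
  then obtain x y where x: "x \<in> carrier G" "X = ?q x" and y: "y \<in> carrier G" "Y = ?q y" and "X \<noteq> Y"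
    by (auto simp: topspace_quotient_topgroup[OF tG N])
       (auto simp: quotient_topgroup_def quotient_proj_def FactGroup_def RCOSETS_def)
  then have xy: "x \<otimes> inv y \<in> carrier G - N"
    using quotient_proj_eq_iff[OF N x(1) y(1)] by simp
  have "continuous_map ?GG ?GG (\<lambda>z. (fst z, inv (snd z)))"
    using tG unfolding topological_group_def
    by (intro continuous_map_pairedI continuous_map_fst
        continuous_map_compose[OF continuous_map_snd, unfolded comp_def]) simp
  then have "continuous_map ?GG (topo G) ((\<lambda>(x, y). x \<otimes> y) \<circ> (\<lambda>z. (fst z, inv (snd z))))"
    using tG by (intro continuous_map_compose) (auto simp: topological_group_def)
  moreover have "openin (topo G) (carrier G - N)"
    using cN by (simp add: closedin_def ts)
  ultimately have "openin ?GG {z \<in> topspace ?GG. ((\<lambda>(x, y). x \<otimes> y) \<circ> (\<lambda>z. (fst z, inv (snd z)))) z \<in> carrier G - N}"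
    (is "openin _ ?W") by (rule openin_continuous_map_preimage)
  moreover have "(x, y) \<in> ?W" using xy x(1) y(1) by (simp add: ts)
  ultimately obtain A B where A: "openin (topo G) A" "x \<in> A" and B: "openin (topo G) B" "y \<in> B"
    and AB: "A \<times> B \<subseteq> ?W"
    unfolding openin_prod_topology_alt by blast
  have "disjnt (?q ` A) (?q ` B)"
  proof -
    have "?q a \<noteq> ?q b" if "a \<in> A" "b \<in> B" for a b
    proof -
      have "(a, b) \<in> A \<times> B" using that by simp
      then have "a \<in> carrier G" "b \<in> carrier G" "a \<otimes> inv b \<notin> N" using AB by (auto simp: ts)
      then show ?thesis using quotient_proj_eq_iff[OF N] by simp
    qed
    then show ?thesis by (auto simp: disjnt_def)
  qed
  then show "\<exists>\<A> \<B>. openin (topo (quotient_topgroup G N)) \<A> \<and>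
      openin (topo (quotient_topgroup G N)) \<B> \<and> X \<in> \<A> \<and> Y \<in> \<B> \<and> disjnt \<A> \<B>"
    using openin_quotient_proj_image[OF tG N] A B x(2) y(2) by blast
qed

section \<open>Continuous homomorphisms\<close>

lemma cont_hom_compose:
  assumes "f \<in> cont_hom G H" "g \<in> cont_hom H K"
  shows "g \<circ> f \<in> cont_hom G K"
  using assms by (auto simp: cont_hom_def intro: hom_compose continuous_map_compose)

lemma cont_hom_equalizer:
  assumes tG: "topological_group G" and H: "group H" "Hausdorff_space (topo H)"
    and f: "f \<in> cont_hom G H" and g: "g \<in> cont_hom G H"
  shows "subgroup {x \<in> carrier G. f x = g x} G"
    and "closedin (topo G) {x \<in> carrier G. f x = g x}"
proof -
  interpret G: group G using tG by (simp add: topological_group_def)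
  have "group_hom G H f" "group_hom G H g"
    using f g H G.is_group by (auto simp: group_hom_def group_hom_axioms_def cont_hom_def)
  then show "subgroup {x \<in> carrier G. f x = g x} G"
    using subgroup_equalizer G.subgroup_self by blast
  show "closedin (topo G) {x \<in> carrier G. f x = g x}"
    using closedin_continuous_maps_eq[OF H(2), of "topo G" f g] f g tG
    by (simp add: cont_hom_def topological_group_def)
qed

lemma kernel_closed_normal:
  assumes tG: "topological_group G" and H: "topological_group H" "Hausdorff_space (topo H)"
    and f: "f \<in> cont_hom G H"
  shows "kernel G H f \<lhd> G" and "closedin (topo G) (kernel G H f)"
proof -
  interpret group_hom G H f by (rule cont_hom_group_hom[OF tG H(1) f])
  show "kernel G H f \<lhd> G" by (rule normal_kernel)
  have "(\<lambda>_. \<one>\<^bsub>H\<^esub>) \<in> cont_hom G H"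
    using H(1) by (auto simp: cont_hom_def hom_def topological_group_def)
  from cont_hom_equalizer(2)[OF tG H.is_group H(2) f this]
  show "closedin (topo G) (kernel G H f)" by (simp add: kernel_def)
qed

lemma cont_hom_image_closed_subgroup:
  assumes tG: "topological_group G" "compact_space (topo G)"
    and H: "topological_group H" "Hausdorff_space (topo H)"
    and f: "f \<in> cont_hom G H"
  shows "subgroup (f ` carrier G) H" and "closedin (topo H) (f ` carrier G)"
proof -
  interpret group_hom G H f by (rule cont_hom_group_hom[OF tG(1) H(1) f])
  show "subgroup (f ` carrier G) H" by (rule img_is_subgroup)
  have "compactin (topo H) (f ` topspace (topo G))"
    using f tG(2) image_compactin[of "topo G" "topspace (topo G)" "topo H" f]
    by (simp add: cont_hom_def compact_space_def)
  then show "closedin (topo H) (f ` carrier G)"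
    using H(2) tG(1) by (simp add: compactin_imp_closedin topological_group_def)
qed

text \<open>The first isomorphism theorem: a continuous map from a compact space onto a Hausdorff space is a
  quotient map, so the homomorphism induced on the image is again continuous.\<close>

lemma cont_hom_factor:
  assumes tP: "topological_group P" "compact_space (topo P)"
    and tG: "topological_group G" "Hausdorff_space (topo G)"
    and tU: "topological_group U"
    and f: "f \<in> cont_hom P G" and surj: "f ` carrier P = carrier G"
    and g: "g \<in> cont_hom P U" and ker: "kernel P G f \<subseteq> kernel P U g"
  obtains h where "h \<in> cont_hom G U" "\<And>x. x \<in> carrier P \<Longrightarrow> h (f x) = g x"
proof -
  interpret f: group_hom P G f by (rule cont_hom_group_hom[OF tP(1) tG(1) f])
  interpret g: group_hom P U g by (rule cont_hom_group_hom[OF tP(1) tU g])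
  have ts: "topspace (topo P) = carrier P" "topspace (topo G) = carrier G" "topspace (topo U) = carrier U"
    using tP tG tU by (simp_all add: topological_group_def)
  have "quotient_map (topo P) (topo G) f"
    using f surj tP(2) tG(2) by (intro continuous_imp_quotient_map) (auto simp: cont_hom_def ts)
  moreover have "continuous_map (topo P) (topo U) g" using g by (simp add: cont_hom_def)
  moreover have "g x = g y" if "x \<in> topspace (topo P)" "y \<in> topspace (topo P)" "f x = f y" for x y
  proof -
    have xy: "x \<in> carrier P" "y \<in> carrier P" using that by (simp_all add: ts)
    then have "x \<otimes>\<^bsub>P\<^esub> inv\<^bsub>P\<^esub> y \<in> kernel P G f" using that(3) by (simp add: kernel_def)
    then have "x \<otimes>\<^bsub>P\<^esub> inv\<^bsub>P\<^esub> y \<in> kernel P U g" using ker by blast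
    then have "g x \<otimes>\<^bsub>U\<^esub> inv\<^bsub>U\<^esub> g y = \<one>\<^bsub>U\<^esub>" using xy by (simp add: kernel_def)
    then show ?thesis using xy g.H.inv_equality g.H.inv_inv g.H.inv_closed g.hom_closed by metis
  qed
  ultimately obtain h where h: "continuous_map (topo G) (topo U) h"
      "\<And>x. x \<in> topspace (topo P) \<Longrightarrow> h (f x) = g x"
    using quotient_map_lift_exists by metis
  have hf: "h (f x) = g x" if "x \<in> carrier P" for x using h(2) that by (simp add: ts)
  have "h (a \<otimes>\<^bsub>G\<^esub> b) = h a \<otimes>\<^bsub>U\<^esub> h b" if ab: "a \<in> carrier G" "b \<in> carrier G" for a b
  proof -
    obtain x y where xy: "x \<in> carrier P" "y \<in> carrier P" "a = f x" "b = f y"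
      using ab surj by blast
    then have "h (a \<otimes>\<^bsub>G\<^esub> b) = h (f (x \<otimes>\<^bsub>P\<^esub> y))" by simp
    also have "\<dots> = g x \<otimes>\<^bsub>U\<^esub> g y" using xy by (subst hf) simp_all
    finally show ?thesis using xy by (simp add: hf)
  qed
  then have "h \<in> cont_hom G U"
    using h(1) continuous_map_funspace[OF h(1)] by (auto simp: cont_hom_def hom_def ts)
  with hf show ?thesis using that by blast
qed

lemma closed_commutator_subgroup_in_kernel:
  assumes tG: "topological_group G" and H: "topological_group H" "Hausdorff_space (topo H)"
    and f: "f \<in> cont_hom G H" and A: "A \<subseteq> carrier G" and B: "B \<subseteq> carrier G"
    and comm: "\<And>a b. a \<in> A \<Longrightarrow> b \<in> B \<Longrightarrow> f a \<otimes>\<^bsub>H\<^esub> f b = f b \<otimes>\<^bsub>H\<^esub> f a"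
  shows "closed_commutator_subgroup G A B \<subseteq> kernel G H f"
proof -
  interpret group_hom G H f by (rule cont_hom_group_hom[OF tG H(1) f])
  let ?S = "{inv\<^bsub>G\<^esub> a \<otimes>\<^bsub>G\<^esub> inv\<^bsub>G\<^esub> b \<otimes>\<^bsub>G\<^esub> a \<otimes>\<^bsub>G\<^esub> b | a b. a \<in> A \<and> b \<in> B}"
  have S: "?S \<subseteq> carrier G" using A B by (auto simp: subset_iff)
  have "inv\<^bsub>G\<^esub> a \<otimes>\<^bsub>G\<^esub> inv\<^bsub>G\<^esub> b \<otimes>\<^bsub>G\<^esub> a \<otimes>\<^bsub>G\<^esub> b \<in> kernel G H f" if ab: "a \<in> A" "b \<in> B" for a b
  proof -
    have c: "a \<in> carrier G" "b \<in> carrier G" using ab A B by auto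
    then have "f (inv\<^bsub>G\<^esub> a \<otimes>\<^bsub>G\<^esub> inv\<^bsub>G\<^esub> b \<otimes>\<^bsub>G\<^esub> a \<otimes>\<^bsub>G\<^esub> b) = inv\<^bsub>H\<^esub> (f b \<otimes>\<^bsub>H\<^esub> f a) \<otimes>\<^bsub>H\<^esub> (f a \<otimes>\<^bsub>H\<^esub> f b)"
      by (simp add: H.m_assoc H.inv_mult_group)
    also have "\<dots> = \<one>\<^bsub>H\<^esub>" using c comm[OF ab] by simp
    finally show ?thesis using c by (simp add: kernel_def)
  qed
  then show ?thesis
    unfolding closed_commutator_subgroup_def
    using kernel_closed_normal[OF tG H f] subgroup_kernel
    by (intro closed_subgroup_generated_props(4)[OF tG S]) auto
qed

section \<open>Linking structures\<close>

lemma ls_Tgrp_pro_p: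
  assumes "prime p" "linking_structure p L" "i \<in> ls_I L"
  shows "pro_p_group p (ls_Tgrp L i)"
  using assms unfolding ls_Tgrp_def linking_structure_def
  by (auto intro!: pro_p_group_closed_subgroup normal_imp_subgroup)

lemma ls_lam_cont_hom_Tgrp:
  assumes L: "linking_structure p L" and i: "i \<in> ls_I L"
  shows "ls_lam L i \<in> cont_hom (ls_Tgrp L i) (ls_G L)"
proof -
  have "ls_T L i \<subseteq> carrier (ls_Z L i)" "ls_lam L i \<in> cont_hom (ls_Z L i) (ls_G L)"
    using L i by (simp_all add: linking_structure_def normal_imp_subgroup subgroup.subset)
  then show ?thesis
    by (auto simp: ls_Tgrp_def cont_hom_def hom_def intro: continuous_map_from_subtopology)
qed

lemma ls_lam_in_carrier:
  assumes "linking_structure p L" "i \<in> ls_I L" "t \<in> ls_T L i"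
  shows "ls_lam L i t \<in> carrier (ls_G L)"
  using ls_lam_cont_hom_Tgrp[OF assms(1,2)] assms(3) by (auto simp: cont_hom_def hom_def ls_Tgrp_def)

lemma globalizations_agree:
  assumes L: "linking_structure p L" and r: "globalization L \<rho>" "globalization L \<sigma>"
    and x: "x \<in> carrier (ls_G L)"
  shows "\<rho> x = \<sigma> x"
proof -
  let ?G = "ls_G L" and ?U = "ls_U L"
  let ?S = "\<Union>i\<in>ls_I L. ls_lam L i ` ls_T L i" and ?E = "{x \<in> carrier ?G. \<rho> x = \<sigma> x}"
  have G: "topological_group ?G" and U: "group ?U" "Hausdorff_space (topo ?U)"
    and gen: "closed_subgroup_generated ?G ?S = carrier ?G"
    using L by (auto simp: linking_structure_def pro_p_group_def topological_group_def)
  have S: "?S \<subseteq> carrier ?G"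
    using ls_lam_in_carrier[OF L] by blast
  have "?S \<subseteq> ?E" using r S by (auto simp: globalization_def)
  then have "closed_subgroup_generated ?G ?S \<subseteq> ?E"
    using r cont_hom_equalizer[OF G U]
    by (intro closed_subgroup_generated_props(4)[OF G S]) (auto simp: globalization_def)
  then show ?thesis using x by (auto simp: gen)
qed

lemma ls_hat_homs:
  assumes p: "prime p" and L: "linking_structure p L"
  shows ls_lam_hat_cont_hom: "ls_lam_hat p L \<in> cont_hom (ls_That p L) (ls_G L)"
    and ls_pi_hat_cont_hom: "ls_pi_hat p L \<in> cont_hom (ls_That p L) (ls_U L)"
    and ls_lam_hat_incl: "\<And>i t. i \<in> ls_I L \<Longrightarrow> t \<in> ls_T L i \<Longrightarrow>
      ls_lam_hat p L (free_pro_p_incl p (ls_I L) (ls_Tgrp L) i t) = ls_lam L i t"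
    and ls_pi_hat_incl: "\<And>i t. i \<in> ls_I L \<Longrightarrow> t \<in> ls_T L i \<Longrightarrow>
      ls_pi_hat p L (free_pro_p_incl p (ls_I L) (ls_Tgrp L) i t) = ls_pi L i t"
proof -
  have G: "pro_p_group p (ls_G L)" and U: "pro_p_group p (ls_U L)"
    and pi: "\<And>i. i \<in> ls_I L \<Longrightarrow> ls_pi L i \<in> cont_hom (ls_Tgrp L i) (ls_U L)"
    using L by (auto simp: linking_structure_def)
  note T = ls_Tgrp_pro_p[OF p L] and lam = ls_lam_cont_hom_Tgrp[OF L]
  have car: "carrier (ls_Tgrp L i) = ls_T L i" for i by (simp add: ls_Tgrp_def)
  note hlam = induced_hom_props[where I = "ls_I L" and T = "ls_Tgrp L" and f = "ls_lam L", OF p G T lam]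
  note hpi = induced_hom_props[where I = "ls_I L" and T = "ls_Tgrp L" and f = "ls_pi L", OF p U T pi]
  show "ls_lam_hat p L \<in> cont_hom (ls_That p L) (ls_G L)"
    unfolding ls_lam_hat_def by (rule hlam(1))
  show "ls_pi_hat p L \<in> cont_hom (ls_That p L) (ls_U L)"
    unfolding ls_pi_hat_def by (rule hpi(1))
  show "ls_lam_hat p L (free_pro_p_incl p (ls_I L) (ls_Tgrp L) i t) = ls_lam L i t"
    if "i \<in> ls_I L" "t \<in> ls_T L i" for i t
    unfolding ls_lam_hat_def using hlam(2) that by (simp add: car)
  show "ls_pi_hat p L (free_pro_p_incl p (ls_I L) (ls_Tgrp L) i t) = ls_pi L i t"
    if "i \<in> ls_I L" "t \<in> ls_T L i" for i t
    unfolding ls_pi_hat_def using hpi(2) that by (simp add: car)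
qed

lemma ls_That_incl_in:
  assumes p: "prime p" and L: "linking_structure p L" and i: "i \<in> ls_I L" and t: "t \<in> ls_T L i"
  shows "free_pro_p_incl p (ls_I L) (ls_Tgrp L) i t \<in> carrier (ls_That p L)"
proof -
  have "topological_group (ls_Tgrp L i)"
    using ls_Tgrp_pro_p[OF p L i] by (simp add: pro_p_group_def)
  from free_pro_p_incl_hom[where T = "ls_Tgrp L", OF p i this] t show ?thesis
    by (auto simp: cont_hom_def hom_def ls_Tgrp_def)
qed

text \<open>The image is compact, hence closed, and it contains the topological generators of \<open>G\<close>.\<close>

lemma ls_lam_hat_surj:
  assumes p: "prime p" and L: "linking_structure p L"
  shows "ls_lam_hat p L ` carrier (ls_That p L) = carrier (ls_G L)"
proof -
  let ?G = "ls_G L" and ?P = "ls_That p L"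
  let ?S = "\<Union>i\<in>ls_I L. ls_lam L i ` ls_T L i" and ?M = "ls_lam_hat p L ` carrier ?P"
  have G: "topological_group ?G" "Hausdorff_space (topo ?G)"
    and gen: "closed_subgroup_generated ?G ?S = carrier ?G"
    using L by (auto simp: linking_structure_def pro_p_group_def)
  have P: "topological_group ?P" "compact_space (topo ?P)"
    using pro_p_group_free_pro_p_product[OF p] by (auto simp: pro_p_group_def)
  note M = cont_hom_image_closed_subgroup[OF P G ls_lam_hat_cont_hom[OF p L]]
  have S: "?S \<subseteq> ?M"
    using ls_lam_hat_incl[OF p L] ls_That_incl_in[OF p L] by (force simp: image_iff)
  then have "closed_subgroup_generated ?G ?S \<subseteq> ?M"
    using M subgroup.subset[OF M(1)] by (intro closed_subgroup_generated_props(4)[OF G(1)]) auto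
  then show ?thesis using gen subgroup.subset[OF M(1)] by auto
qed

lemma globalization_quotient:
  assumes L: "linking_structure p L" and V: "V \<lhd> ls_U L" and r: "globalization L \<rho>"
  shows "globalization (quotient_linking L V) (quotient_proj (ls_U L) V \<circ> \<rho>)"
proof -
  have "topological_group (ls_U L)"
    using L by (auto simp: linking_structure_def pro_p_group_def)
  then show ?thesis
    using r cont_hom_compose[OF _ quotient_proj_cont_hom[OF _ V]]
    by (auto simp: globalization_def quotient_linking_def)
qed

text \<open>Both sides are continuous homomorphisms into a Hausdorff group, and on each factor \<open>T\<^sub>i\<close> they
  are equal to \<open>pr \<circ> \<pi>\<^sub>i\<close>.\<close>

lemma quotient_globalization_lam_hat:
  assumes p: "prime p" and L: "linking_structure p L"
    and V: "V \<lhd> ls_U L" "closedin (topo (ls_U L)) V"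
    and r: "globalization (quotient_linking L V) \<rho>'"
    and x: "x \<in> carrier (ls_That p L)"
  shows "\<rho>' (ls_lam_hat p L x) = quotient_proj (ls_U L) V (ls_pi_hat p L x)"
proof -
  let ?P = "ls_That p L" and ?Q = "quotient_topgroup (ls_U L) V"
  let ?f = "\<rho>' \<circ> ls_lam_hat p L" and ?g = "quotient_proj (ls_U L) V \<circ> ls_pi_hat p L"
  have U: "topological_group (ls_U L)"
    using L by (auto simp: linking_structure_def pro_p_group_def)
  have P: "topological_group ?P"
    using pro_p_group_free_pro_p_product[OF p] by (auto simp: pro_p_group_def)
  have r': "\<rho>' \<in> cont_hom (ls_G L) ?Q"
    and rlam: "\<And>i t. i \<in> ls_I L \<Longrightarrow> t \<in> ls_T L i \<Longrightarrow>
      \<rho>' (ls_lam L i t) = quotient_proj (ls_U L) V (ls_pi L i t)"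
    using r by (auto simp: globalization_def quotient_linking_def)
  have f: "?f \<in> cont_hom ?P ?Q" using cont_hom_compose[OF ls_lam_hat_cont_hom[OF p L] r'] .
  have g: "?g \<in> cont_hom ?P ?Q"
    using cont_hom_compose[OF ls_pi_hat_cont_hom[OF p L] quotient_proj_cont_hom[OF U V(1)]] .
  have "{x \<in> carrier ?P. ?f x = ?g x} = carrier ?P"
  proof (rule free_pro_p_product_generated[OF p])
    fix i t assume "i \<in> ls_I L" "t \<in> carrier (ls_Tgrp L i)"
    then have it: "i \<in> ls_I L" "t \<in> ls_T L i" by (simp_all add: ls_Tgrp_def)
    then show "free_pro_p_incl p (ls_I L) (ls_Tgrp L) i t \<in> {x \<in> carrier ?P. ?f x = ?g x}"
      by (simp add: ls_That_incl_in[OF p L] ls_lam_hat_incl[OF p L] ls_pi_hat_incl[OF p L] rlam)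
  qed (rule cont_hom_equalizer[OF P quotient_topgroup_group[OF V(1)]
        Hausdorff_space_quotient_topgroup[OF U V] f g])+
  then show ?thesis using x by fastforce
qed

text \<open>Since \<open>\<rho>'\<close> is trivial on \<open>\<lambda>\<^sub>i(Z\<^sub>i/T\<^sub>i)\<close>, the map induced by the \<open>\<pi>\<^sub>i\<close> sends the preimage of this
  set in the free product into \<open>V\<close>. The commutators that define the link type then become commutators of elements
  of \<open>V\<close> with elements centralizing \<open>V\<close>.\<close>

lemma link_type_kernel_subset:
  assumes p: "prime p" and L: "linking_structure p L"
    and V: "V \<lhd> ls_U L" "closedin (topo (ls_U L)) V" and link: "has_link_type p L V"
    and r: "globalization (quotient_linking L V) \<rho>'"
    and triv: "\<And>i x. i \<in> ls_I L \<Longrightarrow> x \<in> ls_lam L i ` ls_Zbar L i \<Longrightarrow>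
      \<rho>' x = \<one>\<^bsub>quotient_topgroup (ls_U L) V\<^esub>"
  shows "kernel (ls_That p L) (ls_G L) (ls_lam_hat p L) \<subseteq> kernel (ls_That p L) (ls_U L) (ls_pi_hat p L)"
proof -
  let ?P = "ls_That p L" and ?U = "ls_U L" and ?\<pi> = "ls_pi_hat p L"
  let ?K = "kernel ?P ?U ?\<pi>" and ?C = "{x \<in> carrier ?P. ?\<pi> x \<in> centralizer ?U V}"
  have U: "topological_group ?U" "Hausdorff_space (topo ?U)"
    using L by (auto simp: linking_structure_def pro_p_group_def)
  have P: "topological_group ?P"
    using pro_p_group_free_pro_p_product[OF p] by (auto simp: pro_p_group_def)
  note pi = ls_pi_hat_cont_hom[OF p L]
  interpret pi: group_hom ?P ?U ?\<pi> by (rule cont_hom_group_hom[OF P U(1) pi])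
  have ZV: "?\<pi> z \<in> V" if i: "i \<in> ls_I L" and z: "z \<in> ls_Zhat p L i" for i z
  proof -
    have zP: "z \<in> carrier ?P" using z by (simp add: ls_Zhat_def)
    have "quotient_proj ?U V (?\<pi> z) = \<rho>' (ls_lam_hat p L z)"
      by (rule quotient_globalization_lam_hat[OF p L V r zP, symmetric])
    also have "\<dots> = \<one>\<^bsub>quotient_topgroup ?U V\<^esub>"
      using z by (intro triv[OF i]) (simp add: ls_Zhat_def)
    finally show ?thesis using quotient_proj_eq_one_iff[OF V(1)] zP by simp
  qed
  have comm: "closed_commutator_subgroup ?P ?C (ls_Zhat p L i) \<subseteq> ?K" if "i \<in> ls_I L" for i
    using ZV[OF that]
    by (intro closed_commutator_subgroup_in_kernel[OF P U pi]) (auto simp: centralizer_def ls_Zhat_def)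
  obtain S where S: "S \<subseteq> (\<Union>i\<in>ls_I L. ?K <#>\<^bsub>?P\<^esub> closed_commutator_subgroup ?P ?C (ls_Zhat p L i))"
    and ker: "kernel ?P (ls_G L) (ls_lam_hat p L) = closed_normal_subgroup_generated ?P S"
    using link unfolding has_link_type_def by blast
  have "?K <#>\<^bsub>?P\<^esub> closed_commutator_subgroup ?P ?C (ls_Zhat p L i) \<subseteq> ?K" if "i \<in> ls_I L" for i
    using comm[OF that] subgroup.m_closed[OF pi.subgroup_kernel] by (auto simp: set_mult_def)
  then have "S \<subseteq> ?K" using S by blast
  then show ?thesis
    unfolding ker closed_normal_subgroup_generated_def
    using kernel_closed_normal[OF P U pi] by blast
qed

theorem proposition3p5:
  fixes p :: nat
    and L :: "('g, 'u, 'i, 'z) linking_data"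
    and V :: "'u set"
  assumes "prime p"
    and "linking_structure p L"
    and "V \<lhd> ls_U L" and "closedin (topo (ls_U L)) V"
  shows
    "(\<forall>\<rho>. globalization L \<rho> \<and> (\<forall>i\<in>ls_I L. \<rho> ` ls_lam L i ` ls_Zbar L i \<subseteq> V) \<longrightarrow>
        globalization (quotient_linking L V) (quotient_proj (ls_U L) V \<circ> \<rho>) \<and>
        (\<forall>i\<in>ls_I L. \<forall>x\<in>ls_lam L i ` ls_Zbar L i.
           (quotient_proj (ls_U L) V \<circ> \<rho>) x = \<one>\<^bsub>quotient_topgroup (ls_U L) V\<^esub>)) \<and>
     (has_link_type p L V \<longrightarrow>
        (\<forall>\<rho>'. globalization (quotient_linking L V) \<rho>' \<and>
           (\<forall>i\<in>ls_I L. \<forall>x\<in>ls_lam L i ` ls_Zbar L i.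
              \<rho>' x = \<one>\<^bsub>quotient_topgroup (ls_U L) V\<^esub>) \<longrightarrow>
           (\<exists>!\<rho>. \<rho> \<in> extensional (carrier (ls_G L)) \<and> globalization L \<rho> \<and>
              (\<forall>x\<in>carrier (ls_G L). quotient_proj (ls_U L) V (\<rho> x) = \<rho>' x)) \<and>
           (\<forall>\<rho>. globalization L \<rho> \<and>
              (\<forall>x\<in>carrier (ls_G L). quotient_proj (ls_U L) V (\<rho> x) = \<rho>' x) \<longrightarrow>
              (\<forall>i\<in>ls_I L. \<rho> ` ls_lam L i ` ls_Zbar L i \<subseteq> V))))"
proof (intro conjI allI impI; (elim conjE)?)
  let ?U = "ls_U L" and ?G = "ls_G L"
  note p = assms(1) and L = assms(2) and V = assms(3,4)
  have U: "topological_group ?U" using L by (auto simp: linking_structure_def pro_p_group_def)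
  have lamZ: "x \<in> carrier ?G" if "i \<in> ls_I L" "x \<in> ls_lam L i ` ls_Zbar L i" for i x
  proof -
    have "ls_sec L i \<in> cont_hom (quotient_topgroup (ls_Z L i) (ls_T L i)) (ls_Z L i)"
      "ls_lam L i \<in> cont_hom (ls_Z L i) ?G"
      using L that(1) by (simp_all add: linking_structure_def)
    then show ?thesis using that(2) by (auto simp: ls_Zbar_def cont_hom_def hom_def)
  qed
  have gU: "\<rho> x \<in> carrier ?U" if "globalization L \<rho>" "x \<in> carrier ?G" for \<rho> x
    using that by (auto simp: globalization_def cont_hom_def hom_def)
  {
    fix \<rho> assume r: "globalization L \<rho>"
    then show "globalization (quotient_linking L V) (quotient_proj ?U V \<circ> \<rho>)"
      by (rule globalization_quotient[OF L V(1)])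
    assume sub: "\<forall>i\<in>ls_I L. \<rho> ` ls_lam L i ` ls_Zbar L i \<subseteq> V"
    show "\<forall>i\<in>ls_I L. \<forall>x\<in>ls_lam L i ` ls_Zbar L i.
        (quotient_proj ?U V \<circ> \<rho>) x = \<one>\<^bsub>quotient_topgroup ?U V\<^esub>"
    proof (intro ballI)
      fix i x assume ix: "i \<in> ls_I L" "x \<in> ls_lam L i ` ls_Zbar L i"
      then have "\<rho> x \<in> V" using sub by blast
      then show "(quotient_proj ?U V \<circ> \<rho>) x = \<one>\<^bsub>quotient_topgroup ?U V\<^esub>"
        using quotient_proj_eq_one_iff[OF V(1) gU[OF r lamZ[OF ix]]] by simp
    qed
  next
    fix \<rho>' assume link: "has_link_type p L V" and r': "globalization (quotient_linking L V) \<rho>'"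
      and triv: "\<forall>i\<in>ls_I L. \<forall>x\<in>ls_lam L i ` ls_Zbar L i. \<rho>' x = \<one>\<^bsub>quotient_topgroup ?U V\<^esub>"
    have G: "topological_group ?G" "Hausdorff_space (topo ?G)"
      using L by (auto simp: linking_structure_def pro_p_group_def)
    have P: "topological_group (ls_That p L)" "compact_space (topo (ls_That p L))"
      using pro_p_group_free_pro_p_product[OF p] by (auto simp: pro_p_group_def)
    have "kernel (ls_That p L) ?G (ls_lam_hat p L) \<subseteq> kernel (ls_That p L) ?U (ls_pi_hat p L)"
      using link_type_kernel_subset[OF p L V link r'] triv by blast
    then obtain h where h: "h \<in> cont_hom ?G ?U"
      and hlam: "\<And>x. x \<in> carrier (ls_That p L) \<Longrightarrow> h (ls_lam_hat p L x) = ls_pi_hat p L x"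
      using cont_hom_factor[OF P G U ls_lam_hat_cont_hom[OF p L] ls_lam_hat_surj[OF p L]
          ls_pi_hat_cont_hom[OF p L]] by blast
    have hpi: "h (ls_lam L i t) = ls_pi L i t" if "i \<in> ls_I L" "t \<in> ls_T L i" for i t
      using hlam[OF ls_That_incl_in[OF p L that]] that
      by (simp add: ls_lam_hat_incl[OF p L] ls_pi_hat_incl[OF p L])
    \<comment> \<open>Uniqueness is asserted only among functions with the default value outside \<open>G\<close>.\<close>
    define \<rho> where "\<rho> = restrict h (carrier ?G)"
    have "continuous_map (topo ?G) (topo ?U) \<rho>"
      using h G(1) by (auto simp: \<rho>_def cont_hom_def topological_group_def intro: continuous_map_eq[of _ _ h])
    moreover have "\<rho> \<in> hom ?G ?U"
      using h G(1) by (auto simp: \<rho>_def cont_hom_def hom_def topological_group_def group.is_monoid monoid.m_closed)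
    ultimately have r: "globalization L \<rho>"
      using ls_lam_in_carrier[OF L] hpi by (auto simp: globalization_def cont_hom_def \<rho>_def)
    \<comment> \<open>Every element of \<open>G\<close> comes from the free product, where \<open>\<rho>'\<close> is already known.\<close>
    have lift: "quotient_proj ?U V (\<rho> x) = \<rho>' x" if x: "x \<in> carrier ?G" for x
    proof -
      obtain y where y: "y \<in> carrier (ls_That p L)" "x = ls_lam_hat p L y"
        using x ls_lam_hat_surj[OF p L] by blast
      have "\<rho> x = ls_pi_hat p L y" using x y by (simp add: \<rho>_def hlam)
      then show ?thesis using quotient_globalization_lam_hat[OF p L V r' y(1)] y(2) by simp
    qed
    show "\<exists>!\<rho>. \<rho> \<in> extensional (carrier ?G) \<and> globalization L \<rho> \<and>
        (\<forall>x\<in>carrier ?G. quotient_proj ?U V (\<rho> x) = \<rho>' x)"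
    proof (rule ex1I[of _ \<rho>])
      show "\<rho> \<in> extensional (carrier ?G) \<and> globalization L \<rho> \<and>
          (\<forall>x\<in>carrier ?G. quotient_proj ?U V (\<rho> x) = \<rho>' x)"
        using r lift by (simp add: \<rho>_def)
      show "\<sigma> = \<rho>" if "\<sigma> \<in> extensional (carrier ?G) \<and> globalization L \<sigma> \<and>
          (\<forall>x\<in>carrier ?G. quotient_proj ?U V (\<sigma> x) = \<rho>' x)" for \<sigma>
        using that globalizations_agree[OF L _ r]
        by (intro extensionalityI[of \<sigma> "carrier ?G" \<rho>]) (auto simp: \<rho>_def)
    qed
  next
    fix \<rho>' \<rho> assume triv: "\<forall>i\<in>ls_I L. \<forall>x\<in>ls_lam L i ` ls_Zbar L i. \<rho>' x = \<one>\<^bsub>quotient_topgroup ?U V\<^esub>"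
      and r: "globalization L \<rho>"
      and lift: "\<forall>x\<in>carrier ?G. quotient_proj ?U V (\<rho> x) = \<rho>' x"
    have "\<rho> x \<in> V" if ix: "i \<in> ls_I L" "x \<in> ls_lam L i ` ls_Zbar L i" for i x
      using quotient_proj_eq_one_iff[OF V(1) gU[OF r lamZ[OF ix]]] lift lamZ[OF ix] triv ix by simp
    then show "\<forall>i\<in>ls_I L. \<rho> ` ls_lam L i ` ls_Zbar L i \<subseteq> V" by blast
  }
qed

end
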